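(* Let $i\in\{1,2,3\}$ and let $\tau>0$ be an SINR threshold. In the three-tier network model of the context, the average outage probability $\mathcal{P}_{1,i}$ of the user connected to the $i$-th tier in Case 1 is $$\mathcal{P}_{1,i}=1-\frac{2\pi\lambda_i}{\mathcal{G}_{3,i}}\int_0^\infty x\,\exp\left\{-\frac{x^\beta\sigma^2\tau}{P_i}-\frac{\pi\lambda_i x^2}{\mathcal{G}_{3,i}}\left[1+\frac{\lambda_1+(\lambda_1'-\lambda_1)\mathcal{G}_{3,1}}{\lambda_1}\,\mathcal{Z}_1(\tau)\right]\right\}\mathrm{d}x .$$
   Context: Parameters: real densities $\lambda_0>\lambda_2>\lambda_3>0$; $0<\alpha<1$; $\lambda_1=\alpha\lambda_0$; transmit powers $P_1,P_2,P_3>0$; path-loss exponent $\beta>2$; noise power $\sigma^2\ge 0$; integers $1\le M_1\le N$; $\gamma\ge 0$. The Zipf popularity is $f_n=n^{-\gamma}/\sum_{m=1}^N m^{-\gamma}$ for $1\le n\le N$, and $F(1,M_1)=\sum_{n=1}^{M_1}f_n$. Tier 1 consists of cache-enabled users, tier 2 of relays, tier 3 of base stations. Association probabilities: $\mathcal{G}_{3,i}=\Big[\sum_{j=1}^3\frac{\lambda_j}{\lambda_i}\big(\frac{P_j}{P_i}\big)^{2/\beta}\Big]^{-1}$. Active densities: $\lambda_1'=\min\{\alpha\lambda_0,(1-\alpha)\lambda_0\,\mathcal{G}_{3,1}F(1,M_1)\}$, $\lambda_2'=\lambda_2$, $\lambda_3'=\lambda_3$. Case 1 model (the reference user, at the origin,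 has no cache and is served by the node of maximal received power, lying in tier $i$): the distance $X_i$ from the reference user to its serving node has probability density $$f_{X_i}(x)=\frac{2\pi\lambda_i}{\mathcal{G}_{3,i}}\,x\,\exp\Big(-\pi x^2\sum_{j=1}^3\lambda_j\big(\tfrac{P_j}{P_i}\big)^{2/\beta}\Big),\quad x>0.$$ Conditionally on $X_i=x$, the interfering nodes of tiers $j=1,2,3$ form mutually independent homogeneous Poisson point processes of intensities $\lambda_j'$ on $\{z\in\mathbb{R}^2:|z|\ge x(P_j/P_i)^{1/\beta}\}$. All channel power gains ($g_{i,0}$ of the serving link and $h_{jk}$ of the interfering links) are i.i.d. $\exp(1)$ random variables, independent of all locations. With $|Y_{jk}|$ the distance from the origin to the $k$-th interferer of tier $j$, $$\mathrm{SINR}_i(x)=\frac{P_i g_{i,0}x^{-\beta}}{\sum_{j=1}^3\sum_k P_j h_{jk}|Y_{jk}|^{-\beta}+\sigma^2}.$$ The average outage probability is $\mathcal{P}_{1,i}=\int_0^\infty\mathbb{P}\big[\mathrm{SINR}_i(x)\le\tau\,\big|\,X_i=x\big]f_{X_i}(x)\,\mathrm{d}x$. Function: for $s>0$, $\mathcal{Z}_1(s)=\frac{2s}{\beta-2}\,{}_2F_1\big[1,1-\tfrac{2}{\beta};2-\tfrac{2}{\beta};-s\big]$, where ${}_2F_1$ is the Gauss hypergeometric function (analytically continued to $\mathbb{C}\setminus[1,\infty)$). *)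

theory Defs
  imports "HOL-Probability.Probability" "HOL-Complex_Analysis.Complex_Analysis"
begin

text \<open>
  Tiers are numbered 1 (cache-enabled users), 2 (relays), 3 (base stations).  The densities
  \<open>dens\<close> are indexed so that \<open>dens 0\<close> is the density of all users; the theorem assumes
  \<open>dens 1 = \<alpha> * dens 0\<close>.
\<close>

definition zipf :: "real \<Rightarrow> nat \<Rightarrow> nat \<Rightarrow> real" where
  "zipf \<gamma> N n = real n powr (- \<gamma>) / (\<Sum>m=1..N. real m powr (- \<gamma>))"

definition zipf_sum :: "real \<Rightarrow> nat \<Rightarrow> nat \<Rightarrow> nat \<Rightarrow> real" where
  "zipf_sum \<gamma> N a b = (\<Sum>n=a..b. zipf \<gamma> N n)"

definition assoc_prob :: "(nat \<Rightarrow> real) \<Rightarrow> (nat \<Rightarrow> real) \<Rightarrow> real \<Rightarrow> nat \<Rightarrow> real" where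
  "assoc_prob dens P \<beta> i =
     inverse (\<Sum>j=1..3. dens j / dens i * (P j / P i) powr (2 / \<beta>))"

definition active_density ::
  "(nat \<Rightarrow> real) \<Rightarrow> (nat \<Rightarrow> real) \<Rightarrow> real \<Rightarrow> real \<Rightarrow> real \<Rightarrow> nat \<Rightarrow> nat \<Rightarrow> nat \<Rightarrow> real" where
  "active_density dens P \<alpha> \<beta> \<gamma> N M1 j =
     (if j = 1
      then min (\<alpha> * dens 0)
             ((1 - \<alpha>) * dens 0 * assoc_prob dens P \<beta> 1 * zipf_sum \<gamma> N 1 M1)
      else dens j)"

definition serving_distance_density ::
  "(nat \<Rightarrow> real) \<Rightarrow> (nat \<Rightarrow> real) \<Rightarrow> real \<Rightarrow> nat \<Rightarrow> real \<Rightarrow> real" where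
  "serving_distance_density dens P \<beta> i x =
     (if 0 < x
      then 2 * pi * dens i / assoc_prob dens P \<beta> i * x *
             exp (- pi * x\<^sup>2 * (\<Sum>j=1..3. dens j * (P j / P i) powr (2 / \<beta>)))
      else 0)"

definition point_count :: "(nat \<Rightarrow> 'a \<Rightarrow> real^2) \<Rightarrow> (real^2) set \<Rightarrow> 'a \<Rightarrow> ennreal" where
  "point_count Y A \<omega> = (\<Sum>k. indicator A (Y k \<omega>))"

text \<open>
  A homogeneous Poisson point process of intensity \<open>\<mu>\<close> on \<open>D\<close>, given by an enumeration
  \<open>Y 0, Y 1, \<dots>\<close> of its points.  Since the enumeration is infinite, this is the right
  notion when \<open>\<mu> > 0\<close> and \<open>D\<close> has infinite area: the process then has infinitely many points
  almost surely.
\<close>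

definition homogeneous_ppp ::
  "'a measure \<Rightarrow> real \<Rightarrow> (real^2) set \<Rightarrow> (nat \<Rightarrow> 'a \<Rightarrow> real^2) \<Rightarrow> bool" where
  "homogeneous_ppp M \<mu> D Y \<longleftrightarrow>
     (\<forall>k. Y k \<in> borel_measurable M) \<and>
     (AE \<omega> in M. \<forall>k. Y k \<omega> \<in> D) \<and>
     (\<forall>A\<in>sets borel. A \<subseteq> D \<longrightarrow> emeasure lborel A < \<infinity> \<longrightarrow>
        (\<forall>n. measure M {\<omega>\<in>space M. point_count Y A \<omega> = of_nat n} =
               exp (- (\<mu> * measure lborel A)) * (\<mu> * measure lborel A) ^ n / fact n)) \<and>
     (\<forall>n (A :: nat \<Rightarrow> (real^2) set).
        (\<forall>l<n. A l \<in> sets borel \<and> A l \<subseteq> D) \<longrightarrow> disjoint_family_on A {..<n} \<longrightarrow>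
        prob_space.indep_vars M (\<lambda>_. borel) (\<lambda>l. point_count Y (A l)) {..<n})"

text \<open>
  All channel gains as one family: index \<open>None\<close> is the serving link and \<open>Some (j, k)\<close> the link
  from the \<open>k\<close>-th interferer of tier \<open>j\<close>.
\<close>

definition gain_family ::
  "('a \<Rightarrow> real) \<Rightarrow> (nat \<Rightarrow> nat \<Rightarrow> 'a \<Rightarrow> real) \<Rightarrow> (nat \<times> nat) option \<Rightarrow> 'a \<Rightarrow> real" where
  "gain_family g h p = (case p of None \<Rightarrow> g | Some (j, k) \<Rightarrow> h j k)"

definition gain_index :: "(nat \<times> nat) option set" where
  "gain_index = insert None (Some ` ({1..3} \<times> UNIV))"

text \<open>
  The law \<open>M\<close> of the network given that the serving node lies in tier \<open>i\<close> at distance \<open>x\<close>.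
  Independence of the tiers is independence of the point processes as random counting measures;
  independence of gains and locations is that of the generated sigma-algebras.
\<close>

definition conditional_network ::
  "(nat \<Rightarrow> real) \<Rightarrow> (nat \<Rightarrow> real) \<Rightarrow> real \<Rightarrow> nat \<Rightarrow> real \<Rightarrow> 'a measure \<Rightarrow>
   ('a \<Rightarrow> real) \<Rightarrow> (nat \<Rightarrow> nat \<Rightarrow> 'a \<Rightarrow> real) \<Rightarrow> (nat \<Rightarrow> nat \<Rightarrow> 'a \<Rightarrow> real^2) \<Rightarrow> bool" where
  "conditional_network dens' P \<beta> i x M g h Y \<longleftrightarrow>
     (\<forall>j\<in>{1..3}. homogeneous_ppp M (dens' j) {z. x * (P j / P i) powr (1 / \<beta>) \<le> norm z} (Y j)) \<and>
     prob_space.indep_vars M (\<lambda>_. PiM (sets borel) (\<lambda>_. borel))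
       (\<lambda>j \<omega>. \<lambda>A\<in>sets borel. point_count (Y j) A \<omega>) {1..3} \<and>
     (\<forall>p\<in>gain_index. distributed M lborel (gain_family g h p) (\<lambda>t. ennreal (exponential_density 1 t))) \<and>
     prob_space.indep_vars M (\<lambda>_. borel) (gain_family g h) gain_index \<and>
     prob_space.indep_set M
       (sets (vimage_algebra (space M) (\<lambda>\<omega>. \<lambda>p\<in>gain_index. gain_family g h p \<omega>)
                (PiM gain_index (\<lambda>_. borel))))
       (sets (vimage_algebra (space M) (\<lambda>\<omega>. \<lambda>(j, k)\<in>{1..3} \<times> UNIV. Y j k \<omega>)
                (PiM ({1..3} \<times> UNIV) (\<lambda>_. borel))))"

text \<open>\<open>K x\<close> is a regular version of the conditional probability \<open>M[ \<cdot> | X = x]\<close>.\<close>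

definition regular_cond_prob :: "'a measure \<Rightarrow> ('a \<Rightarrow> real) \<Rightarrow> (real \<Rightarrow> 'a measure) \<Rightarrow> bool" where
  "regular_cond_prob M X K \<longleftrightarrow>
     K \<in> borel \<rightarrow>\<^sub>M prob_algebra M \<and>
     (\<forall>A\<in>sets M. \<forall>B\<in>sets borel.
        emeasure M (A \<inter> X -` B) = (\<integral>\<^sup>+x\<in>B. emeasure (K x) A \<partial>distr M borel X))"

definition case1_model ::
  "(nat \<Rightarrow> real) \<Rightarrow> (nat \<Rightarrow> real) \<Rightarrow> (nat \<Rightarrow> real) \<Rightarrow> real \<Rightarrow> nat \<Rightarrow> 'a measure \<Rightarrow>
   ('a \<Rightarrow> real) \<Rightarrow> (real \<Rightarrow> 'a measure) \<Rightarrow>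
   ('a \<Rightarrow> real) \<Rightarrow> (nat \<Rightarrow> nat \<Rightarrow> 'a \<Rightarrow> real) \<Rightarrow> (nat \<Rightarrow> nat \<Rightarrow> 'a \<Rightarrow> real^2) \<Rightarrow> bool" where
  "case1_model dens dens' P \<beta> i M X K g h Y \<longleftrightarrow>
     prob_space M \<and>
     distributed M lborel X (\<lambda>x. ennreal (serving_distance_density dens P \<beta> i x)) \<and>
     regular_cond_prob M X K \<and>
     (AE x in lborel. 0 < x \<longrightarrow> conditional_network dens' P \<beta> i x (K x) g h Y)"

text \<open>
  Values in \<open>ennreal\<close>, so that the infinite interference sum is always meaningful (an infinite
  interference gives SINR 0).  Gains are nonnegative almost surely, so \<open>ennreal\<close> truncates
  nothing outside a null set.
\<close>

definition sinr ::
  "(nat \<Rightarrow> real) \<Rightarrow> real \<Rightarrow> real \<Rightarrow> nat \<Rightarrow>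
   ('a \<Rightarrow> real) \<Rightarrow> (nat \<Rightarrow> nat \<Rightarrow> 'a \<Rightarrow> real) \<Rightarrow> (nat \<Rightarrow> nat \<Rightarrow> 'a \<Rightarrow> real^2) \<Rightarrow>
   real \<Rightarrow> 'a \<Rightarrow> ennreal" where
  "sinr P \<beta> \<sigma> i g h Y x \<omega> =
     ennreal (P i * g \<omega> * x powr (- \<beta>)) /
     ((\<Sum>j=1..3. \<Sum>k. ennreal (P j * h j k \<omega> * norm (Y j k \<omega>) powr (- \<beta>))) + ennreal (\<sigma>\<^sup>2))"

definition outage_prob ::
  "(nat \<Rightarrow> real) \<Rightarrow> (nat \<Rightarrow> real) \<Rightarrow> real \<Rightarrow> real \<Rightarrow> real \<Rightarrow> nat \<Rightarrow> (real \<Rightarrow> 'a measure) \<Rightarrow>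
   ('a \<Rightarrow> real) \<Rightarrow> (nat \<Rightarrow> nat \<Rightarrow> 'a \<Rightarrow> real) \<Rightarrow> (nat \<Rightarrow> nat \<Rightarrow> 'a \<Rightarrow> real^2) \<Rightarrow> real" where
  "outage_prob dens P \<beta> \<sigma> \<tau> i K g h Y =
     (LBINT x:{0<..}.
        measure (K x) {\<omega>\<in>space (K x). sinr P \<beta> \<sigma> i g h Y x \<omega> \<le> ennreal \<tau>} *
        serving_distance_density dens P \<beta> i x)"

text \<open>
  The Gauss hypergeometric function on the plane slit along \<open>[1, \<infinity>)\<close>: the holomorphic function
  there whose Taylor expansion at 0 is the hypergeometric series (\<open>c\<close> not a nonpositive integer).
  It is unique because the slit plane is connected.
\<close>

definition hypergeometric_2F1 :: "complex \<Rightarrow> complex \<Rightarrow> complex \<Rightarrow> complex \<Rightarrow> complex" where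
  "hypergeometric_2F1 a b c z =
     (THE w. \<exists>f. f holomorphic_on (- (complex_of_real ` {1..})) \<and>
                 f has_fps_expansion fps_hypergeo [a, b] [c] 1 \<and> w = f z)"

text \<open>For real \<open>s > 0\<close> the hypergeometric value is real, so \<open>Re\<close> only changes the type.\<close>

definition Z1 :: "real \<Rightarrow> real \<Rightarrow> real" where
  "Z1 \<beta> s = 2 * s / (\<beta> - 2) *
     Re (hypergeometric_2F1 1 (complex_of_real (1 - 2 / \<beta>)) (complex_of_real (2 - 2 / \<beta>))
           (complex_of_real (- s)))"

end

theory Submission
  imports Defs
begin

text \<open>
  At serving distance \<open>x\<close> the outage event says that the exponential gain of the serving link is at
  most \<open>T = s (I + \<sigma>\<^sup>2)\<close> with \<open>s = \<tau> x\<^sup>\<beta> / P\<^sub>i\<close>, so its probability is one minus the Laplace transform of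
  the interference \<open>I\<close> at \<open>s\<close>, times the noise factor.  Integrating out the interferers' gains turns each
  interferer at \<open>z\<close> into a factor \<open>1 / (1 + s P\<^sub>j |z|\<^sup>-\<^sup>\<beta>)\<close>, and the Laplace functional of the Poisson process
  gives \<open>exp (- \<lambda>'\<^sub>j \<integral> (1 - 1 / (1 + s P\<^sub>j |z|\<^sup>-\<^sup>\<beta>)) dz)\<close> for each tier.  In polar coordinates this integral
  is Euler's integral for \<open>\<^sub>2F\<^sub>1\<close>, equal to \<open>\<pi> x\<^sup>2 (P\<^sub>j / P\<^sub>i)\<^sup>2\<^sup>/\<^sup>\<beta> Z\<^sub>1(\<tau>)\<close>: the exclusion radius is chosen
  so that \<open>x\<close> and the powers scale out.
\<close>

text \<open>Sums over interferers are taken in \<open>ennreal\<close>, where they always exist.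
  Almost sure finiteness of the interference is never proved: an infinite value means certain outage
  and Laplace factor 0, and the formulas cover it. The factors 1 / (1 + y) are carried as
  \<open>nexp\<close> of ln (1 + y), which turns an infinite product over the points into a sum over
  the points, the shape that the Laplace functional evaluates. Two kinds of independence shape the
  argument. Gains and positions generate independent sigma-algebras, so positions can be frozen
  while gains are integrated out. The tiers are independent only through their counts, so splitting
  the expectation over the tiers has to pass through counts. The bracket in the result is algebra:
  only tier 1 changes its density, and the serving-distance density supplies the summand 1. The
  leading 1 is the total mass of that density. What remains delicate in the averaging is
  measurability in x, since both the outage event and the law it is measured by depend on x.\<close>

section \<open>The functional exp (- x) on the extended nonnegative reals\<close>

text \<open>\<open>enn2real\<close> sends \<open>\<top>\<close> to 0, which would give exp 0 = 1;
  the separate case restores the limit value 0 and with it continuity and multiplicativity on all of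
  \<open>ennreal\<close>.\<close>

definition nexp :: "ennreal \<Rightarrow> real" where
  "nexp x = (if x = \<top> then 0 else exp (- enn2real x))"

lemma nexp_simps [simp]: "nexp \<top> = 0" "nexp 0 = 1" "0 \<le> r \<Longrightarrow> nexp (ennreal r) = exp (- r)"
  by (auto simp: nexp_def)

lemma nexp_nonneg [simp]: "0 \<le> nexp x"
  by (simp add: nexp_def)

lemma nexp_le_1 [simp]: "nexp x \<le> 1"
  by (simp add: nexp_def)

lemma nexp_add: "nexp (x + y) = nexp x * nexp y"
  by (cases x; cases y) (auto simp: exp_diff exp_minus divide_inverse simp flip: ennreal_plus exp_add)

lemma nexp_antimono: "x \<le> y \<Longrightarrow> nexp y \<le> nexp x"
  by (cases x; cases y) (auto simp: top_unique)

lemma nexp_sum: "nexp (sum f A) = (\<Prod>i\<in>A. nexp (f i))"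
  by (induction A rule: infinite_finite_induct) (auto simp: nexp_add)

lemma measurable_nexp [measurable]: "nexp \<in> borel_measurable borel"
  unfolding nexp_def by measurable

lemma tendsto_nexp:
  assumes "(f \<longlongrightarrow> x) F"
  shows "((\<lambda>n. nexp (f n)) \<longlongrightarrow> nexp x) F"
proof (cases x)
  case (real r)
  have ev: "eventually (\<lambda>n. f n < \<top>) F"
    using order_tendstoD(2)[OF assms, of \<top>] real by simp
  have "((\<lambda>n. exp (- enn2real (f n))) \<longlongrightarrow> exp (- r)) F"
    using assms real by (intro tendsto_intros) (auto intro!: tendsto_enn2real)
  then show ?thesis
    using real eventually_mono[OF ev, of "\<lambda>n. exp (- enn2real (f n)) = nexp (f n)"]
    by (auto elim!: Lim_transform_eventually simp: nexp_def)
next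
  case top
  show ?thesis
    unfolding top nexp_simps
  proof (rule tendstoI)
    fix e :: real assume e: "0 < e"
    \<comment> \<open>Beyond - ln e the exponential is below e; the maximum with 0 keeps
      \<open>ennreal R\<close> from truncating.\<close>
    define R where "R = max 0 (- ln e)"
    have "eventually (\<lambda>n. ennreal R < f n) F"
      using order_tendstoD(1)[OF assms, of "ennreal R"] top by simp
    then show "eventually (\<lambda>n. dist (nexp (f n)) 0 < e) F"
    proof eventually_elim
      case (elim n)
      show ?case
      proof (cases "f n")
        case (real q)
        moreover have "0 \<le> R" by (simp add: R_def)
        ultimately have "R < q" using elim by (simp add: ennreal_less_iff)
        then have "- q < ln e" by (simp add: R_def)
        then have "exp (- q) < e" using e by (metis exp_less_cancel_iff exp_ln)
        then show ?thesis using real by simp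
      qed (use e in simp)
    qed
  qed
qed

section \<open>Euler's integral for the hypergeometric function\<close>

lemma slit_denominator_nonzero:
  assumes "z \<in> - (complex_of_real ` {1..})" "t \<in> {0..1}"
  shows "1 - z * of_real t \<noteq> 0"
proof
  assume eq: "1 - z * of_real t = 0"
  then have t: "t \<noteq> 0" by auto
  with eq have "z = of_real (1 / t)" by (simp add: field_simps)
  moreover have "1 / t \<in> {1..}" using assms(2) t by (auto simp: field_simps)
  ultimately show False using assms(1) by blast
qed

text \<open>Differentiation under the integral. The slit plane is not convex, so the Leibniz rule is
  applied on a ball around each point, where the denominator has no zero.\<close>

lemma euler_integral_holomorphic:
  assumes "c > 0"
  shows "(\<lambda>z. integral {0..1} (\<lambda>u. 1 / (1 - z * of_real (u powr c))))
           holomorphic_on - (complex_of_real ` {1..})" (is "?F holomorphic_on ?S")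
proof -
  have op: "open ?S"
    by (intro open_Compl closed_slot_right)
  have pw: "u powr c \<in> {0..1}" if "u \<in> {0..1}" for u :: real
    using that assms by (auto intro!: powr_le1)
  have cont_powr: "continuous_on A (\<lambda>u::real. u powr c)" if "A \<subseteq> {0..}" for A
    using assms that by (intro continuous_on_powr') (auto intro!: continuous_intros)
  have "?F field_differentiable at z within ?S" if z: "z \<in> ?S" for z
  proof -
    obtain e where e: "e > 0" "ball z e \<subseteq> ?S"
      using op z open_contains_ball by blast
    have "(\<lambda>z. integral (cbox 0 1) (\<lambda>u. 1 / (1 - z * of_real (u powr c)))) holomorphic_on ball z e"
    proof (rule leibniz_rule_holomorphic)
      fix w and u :: real assume "w \<in> ball z e" "u \<in> cbox 0 1"
      then have "1 - w * of_real (u powr c) \<noteq> 0"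
        using e pw by (intro slit_denominator_nonzero) auto
      then show "((\<lambda>w. 1 / (1 - w * of_real (u powr c))) has_field_derivative
          of_real (u powr c) / (1 - w * of_real (u powr c))\<^sup>2) (at w within ball z e)"
        by (auto intro!: derivative_eq_intros simp: power2_eq_square)
    next
      fix w assume w: "w \<in> ball z e"
      have "continuous_on {0..1} (\<lambda>u. 1 / (1 - w * of_real (u powr c)))"
        using w e pw by (intro continuous_intros cont_powr ballI slit_denominator_nonzero) auto
      then show "(\<lambda>u. 1 / (1 - w * of_real (u powr c))) integrable_on cbox 0 1"
        by (simp add: integrable_continuous_real)
    next
      have c2: "continuous_on (ball z e \<times> cbox 0 (1::real)) (\<lambda>x. snd x powr c)"
        by (rule continuous_on_compose2[OF cont_powr[of "{0..1}"], of _ snd])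
           (auto intro!: continuous_intros)
      have "continuous_on (ball z e \<times> cbox 0 (1::real))
          (\<lambda>x. of_real (snd x powr c) / (1 - fst x * of_real (snd x powr c))\<^sup>2)"
        using e pw by (intro continuous_intros c2)
          (auto dest!: slit_denominator_nonzero[rotated, OF pw])
      then show "continuous_on (ball z e \<times> cbox 0 1)
          (\<lambda>(x, t). complex_of_real (t powr c) / (1 - x * of_real (t powr c))\<^sup>2)"
        by (simp add: case_prod_beta)
    qed auto
    then have "?F field_differentiable at z"
      using e(1) by (intro holomorphic_on_imp_differentiable_at[where s = "ball z e"]) auto
    then show ?thesis by (rule field_differentiable_at_within)
  qed
  then show ?thesis by (simp add: holomorphic_on_def)
qed

text \<open>The geometric series in z * u powr c converges uniformly in u because u powr c stays in
  [0, 1], so it may be integrated termwise; the n-th term contributes the integral of u powr (c *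
  n).\<close>

lemma euler_integral_sums:
  fixes z :: complex
  assumes c: "c > 0" and z: "norm z < 1"
  shows "(\<lambda>n. z ^ n / of_real (c * real n + 1)) sums
           integral {0..1} (\<lambda>u. 1 / (1 - z * of_real (u powr c)))"
proof -
  let ?f = "\<lambda>n (u::real). (z * of_real (u powr c)) ^ n"
  have pw: "u powr c \<in> {0..1}" if "u \<in> {0..1}" for u :: real
    using that c by (auto intro!: powr_le1)
  have nrm: "norm (z * of_real (u powr c)) \<le> norm z" if "u \<in> {0..1}" for u :: real
    using pw[OF that] by (auto simp: norm_mult intro!: mult_left_le)
  have "uniform_limit {0..1} (\<lambda>n u. \<Sum>k<n. ?f k u) (\<lambda>u. suminf (\<lambda>k. ?f k u)) sequentially"
    using nrm z by (intro Weierstrass_m_test[where M = "\<lambda>n. norm z ^ n"])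
      (auto simp: norm_power summable_geometric intro!: power_mono)
  moreover have "suminf (\<lambda>k. ?f k u) = 1 / (1 - z * of_real (u powr c))" if "u \<in> {0..1}" for u
    using nrm[OF that] z by (intro suminf_geometric) auto
  ultimately have ul: "uniform_limit {0..1} (\<lambda>n u. \<Sum>k<n. ?f k u)
      (\<lambda>u. 1 / (1 - z * of_real (u powr c))) sequentially"
    by (subst uniform_limit_cong'[where g = "\<lambda>n u. \<Sum>k<n. ?f k u" 
        and i = "\<lambda>u. suminf (\<lambda>k. ?f k u)"]) auto
  have cont: "continuous_on {0..1} (\<lambda>u. \<Sum>k<n. ?f k u)" for n
    using c by (intro continuous_intros continuous_on_powr') auto
  have has: "(?f n has_integral z ^ n / of_real (c * real n + 1)) {0..1}" for n
  proof -
    have "((\<lambda>u::real. u powr (c * real n)) has_integral 1 powr (c * real n + 1) / (c * real n + 1)) {0..1}"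
      using c by (intro has_integral_powr_from_0) (auto intro: less_le_trans[of _ 0])
    then have "((\<lambda>u. z ^ n * complex_of_real (u powr (c * real n))) has_integral
        z ^ n * of_real (1 / (c * real n + 1))) {0..1}"
      by (intro has_integral_mult_right has_integral_of_real) simp
    \<comment> \<open>The integrands differ at u = 0 when n = 0, since 0 powr 0 = 0 but 0 ^ 0 = 1;
      hence the null set {0}.\<close>
    then have "(?f n has_integral z ^ n * of_real (1 / (c * real n + 1))) {0..1}"
      by (rule has_integral_spike[of "{0}", rotated -1])
         (auto simp: power_mult_distrib powr_powr[symmetric] powr_realpow simp flip: of_real_power)
    then show ?thesis by simp
  qed
  obtain I J where I: "\<And>n. ((\<lambda>u. \<Sum>k<n. ?f k u) has_integral I n) {0..1}"
    and J: "((\<lambda>u. 1 / (1 - z * of_real (u powr c))) has_integral J) {0..1}" and lim: "I \<longlonglongrightarrow> J"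
    using uniform_limit_integral[OF ul cont] by auto
  have "I = (\<lambda>n. \<Sum>k<n. z ^ k / of_real (c * real k + 1))"
    by (intro ext has_integral_unique[OF I]) (intro has_integral_sum has finite_lessThan)
  with lim J show ?thesis
    by (simp add: sums_def integral_unique)
qed

text \<open>
  The integrand \<open>b t\<^sup>b\<^sup>-\<^sup>1 / (1 - z t)\<close> of Euler's integral is rewritten by \<open>t = u\<^sup>1\<^sup>/\<^sup>b\<close>, which removes
  the singularity at 0 and makes the integrand continuous in both variables.
\<close>

theorem hypergeometric_2F1_euler:
  fixes b :: real
  assumes b: "b > 0" and z: "z \<in> - (complex_of_real ` {1..})"
  shows "hypergeometric_2F1 1 (of_real b) (of_real (b + 1)) z =
           integral {0..1} (\<lambda>u. 1 / (1 - z * of_real (u powr (1 / b))))"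
proof -
  let ?S = "- (complex_of_real ` {1..})"
  let ?F = "\<lambda>z. integral {0..1} (\<lambda>u. 1 / (1 - z * of_real (u powr (1 / b))))"
  let ?H = "fps_hypergeo [1, of_real b] [of_real (b + 1)] (1::complex)"
  have op: "open ?S"
    by (intro open_Compl closed_slot_right)
  have conn: "connected ?S"
    by (intro starlike_imp_connected starlike_slotted_complex_plane_right)
  have zero: "0 \<in> ?S" by auto
  \<comment> \<open>The parameter 1 contributes n!, which cancels the factorial of the series. The
    rest is (b)_n / (b+1)_n = b / (b + n), as both sides of the next identity are the Pochhammer
    symbol (b)_(n+1).\<close>
  have coeff: "?H $ n = 1 / of_real (1 / b * real n + 1)" for n
  proof -
    have nz: "pochhammer (of_real (b + 1)) n \<noteq> (0::complex)"
      using b by (simp only: pochhammer_of_real of_real_eq_0_iff) (simp add: pochhammer_eq_0_iff)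
    have "pochhammer (of_real b :: complex) n * (of_real b + of_nat n) =
        of_real b * pochhammer (of_real (b + 1)) n"
      using pochhammer_rec[of "of_real b :: complex" n] pochhammer_rec'[of "of_real b :: complex" n]
      by (simp add: mult_ac)
    moreover have "complex_of_real b \<noteq> 0"
      using b by simp
    moreover have "complex_of_real (b + real n) \<noteq> 0"
      using b by (simp only: of_real_eq_0_iff)
    then have "complex_of_real b + of_nat n \<noteq> 0" by simp
    ultimately have "pochhammer (of_real b) n / pochhammer (of_real (b + 1)) n =
        complex_of_real b / (complex_of_real b + of_nat n)"
      using nz by (subst frac_eq_eq) auto
    also have "\<dots> = 1 / of_real (1 / b * real n + 1)"
      using b by (simp add: divide_simps add.commute)
    finally show ?thesis
      by (simp flip: pochhammer_fact)
  qed
  have hol: "?F holomorphic_on ?S"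
    using b by (intro euler_integral_holomorphic) auto
  have exp: "?F has_fps_expansion ?H"
  proof (rule has_fps_expansionI)
    have "eventually (\<lambda>u::complex. u \<in> ball 0 1) (nhds 0)"
      by (intro eventually_nhds_in_open) auto
    then show "eventually (\<lambda>u. (\<lambda>n. ?H $ n * u ^ n) sums ?F u) (nhds 0)"
    proof eventually_elim
      case (elim u)
      then have "(\<lambda>n. u ^ n / of_real (1 / b * real n + 1)) sums ?F u"
        using b by (intro euler_integral_sums) auto
      then show ?case unfolding coeff by simp
    qed
  qed
  show ?thesis
    unfolding hypergeometric_2F1_def
  proof (rule the_equality)
    show "\<exists>f. f holomorphic_on ?S \<and> f has_fps_expansion ?H \<and> ?F z = f z"
      using hol exp by blast
  next
    fix w assume "\<exists>f. f holomorphic_on ?S \<and> f has_fps_expansion ?H \<and> w = f z"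
    then obtain f where f: "f holomorphic_on ?S" "f has_fps_expansion ?H" "w = f z" by blast
    have "(\<lambda>z. f z - ?F z) has_fps_expansion 0"
      using has_fps_expansion_diff[OF f(2) exp] by simp
    then have "f z - ?F z = 0"
      using f hol op conn zero z
      by (intro has_fps_expansion_0_analytic_continuation[where A = ?S and f = "\<lambda>z. f z - ?F z"])
         (auto intro!: holomorphic_intros)
    then show "w = ?F z" using f by simp
  qed
qed

text \<open>Euler's integral with b = 1 - 2 / \<beta>, whence b + 1 = 2 - 2 / \<beta> and the
  exponent 1 / b = \<beta> / (\<beta> - 2). For real s the integrand is real, which disposes of
  \<open>Re\<close>.\<close>

lemma Z1_eq_integral:
  assumes "\<beta> > 2" "s > 0"
  shows "Z1 \<beta> s = 2 * s / (\<beta> - 2) * integral {0..1} (\<lambda>u. 1 / (1 + s * u powr (\<beta> / (\<beta> - 2))))"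
proof -
  define c where "c = \<beta> / (\<beta> - 2)"
  have c: "c > 0" "1 / (1 - 2 / \<beta>) = c" using assms by (auto simp: c_def field_simps)
  have "hypergeometric_2F1 1 (of_real (1 - 2 / \<beta>)) (of_real (2 - 2 / \<beta>)) (of_real (- s))
      = integral {0..1} (\<lambda>u. 1 / (1 - complex_of_real (- s) * of_real (u powr c)))"
  proof -
    have "of_real (- s) \<in> - (complex_of_real ` {1..})"
      using assms by (auto simp del: of_real_minus)
    moreover have "1 - 2 / \<beta> > 0" using assms by (simp add: field_simps)
    moreover have "2 - 2 / \<beta> = 1 - 2 / \<beta> + 1" by simp
    ultimately show ?thesis
      using hypergeometric_2F1_euler[of "1 - 2 / \<beta>" "of_real (- s)"] by (simp only: c(2))
  qed
  also have "\<dots> = integral {0..1} (\<lambda>u. complex_of_real (1 / (1 + s * u powr c)))"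
    by simp
  also have "\<dots> = of_real (integral {0..1} (\<lambda>u. 1 / (1 + s * u powr c)))"
  proof -
    have "1 + s * u powr c > 0" for u using assms by (intro add_pos_nonneg) auto
    then have "continuous_on {0..1} (\<lambda>u. 1 / (1 + s * u powr c))"
      using c by (intro continuous_intros continuous_on_powr') (auto simp: less_imp_neq[symmetric])
    then have "(\<lambda>u. 1 / (1 + s * u powr c)) integrable_on {0..1}"
      by (rule integrable_continuous_real)
    then show ?thesis
      by (intro integral_unique has_integral_of_real) (simp add: integrable_integral)
  qed
  finally show ?thesis unfolding Z1_def c_def by simp
qed

section \<open>Polar integration of the interference kernel\<close>

text \<open>Integration of radial functions needs only the law of the norm, and that law is
  determined by the areas of discs: pi * a^2 is the integral of 2 * pi * r over [0, a].\<close>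

lemma distr_norm_lborel:
  "distr lborel borel (norm :: real^2 \<Rightarrow> real) =
     density lborel (\<lambda>r. ennreal (2 * pi * r) * indicator {0..} r)" (is "?M = ?N")
proof (rule measure_eqI_generator_eq[where E = "range atMost" and \<Omega> = UNIV and A = "\<lambda>n. {..real n}"])
  fix A :: "real set" assume "A \<in> range atMost"
  then obtain a where A: "A = {..a}" by auto
  have *: "norm -` {..a} \<inter> space lborel = cball (0::real^2) a"
    by (auto simp: dist_norm)
  have "emeasure ?M A = emeasure lborel (cball (0::real^2) a)"
    by (simp add: emeasure_distr A * del: space_lborel)
  also have "\<dots> = emeasure ?N A"
  proof (cases "0 \<le> a")
    case True
    have "emeasure ?N A = (\<integral>\<^sup>+r. ennreal (2 * pi * r) * indicator {0..a} r \<partial>lborel)"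
      by (auto simp: emeasure_density A intro!: nn_integral_cong split: split_indicator)
    also have "\<dots> = ennreal (pi * a\<^sup>2 - pi * 0\<^sup>2)"
      using True by (intro nn_integral_FTC_Icc[where F = "\<lambda>r. pi * r\<^sup>2"])
        (auto intro!: derivative_eq_intros)
    finally show ?thesis
      using True by (simp add: emeasure_cball unit_ball_vol_2)
  next
    case False
    have "emeasure ?N A = (\<integral>\<^sup>+r. ennreal (2 * pi * r) * indicator {0..} r * indicator A r \<partial>lborel)"
      by (subst emeasure_density) (auto simp: A)
    also have "\<dots> = (\<integral>\<^sup>+r. 0 \<partial>(lborel :: real measure))"
      using False A by (intro nn_integral_cong) (auto split: split_indicator)
    finally have "emeasure ?N A = 0" by simp
    with False show ?thesis by simp
  qed
  finally show "emeasure ?M A = emeasure ?N A" .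
next
  show "(\<Union>n. {..real n}) = UNIV"
    using real_arch_simple by auto
  have *: "norm -` {..real n} = cball (0::real^2) (real n)" for n
    by (auto simp: dist_norm)
  show "emeasure ?M {..real n} \<noteq> \<infinity>" for n
    by (simp add: emeasure_distr * emeasure_cball)
qed (auto simp: Int_stable_def borel_eq_atMost)

lemma nn_integral_radial:
  assumes [measurable]: "f \<in> borel_measurable borel"
  shows "(\<integral>\<^sup>+z. f (norm (z :: real^2)) \<partial>lborel) =
           (\<integral>\<^sup>+r. ennreal (2 * pi * r) * indicator {0..} r * f r \<partial>lborel)"
proof -
  have "(\<integral>\<^sup>+z. f (norm (z :: real^2)) \<partial>lborel) = (\<integral>\<^sup>+r. f r \<partial>distr lborel borel (norm :: real^2 \<Rightarrow> real))"
    by (subst nn_integral_distr) auto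
  also have "\<dots> = (\<integral>\<^sup>+r. ennreal (2 * pi * r) * indicator {0..} r * f r \<partial>lborel)"
    unfolding distr_norm_lborel by (subst nn_integral_density) auto
  finally show ?thesis .
qed

text \<open>With q = r / r0 the hypothesis on \<open>a\<close> turns a * r powr (- \<beta>) into
  \<tau> * q powr (- \<beta>), so the radius contributes only r0^2 from r dr. Putting u = q powr (2
  - \<beta>) maps [r0, \<infinity>) onto (0, 1], absorbs the numerator q powr (1 - \<beta>) into du,
  and gives u powr c = q powr (- \<beta>) because (2 - \<beta>) * c = - \<beta>.\<close>

lemma nn_integral_interference:
  assumes \<beta>: "\<beta> > 2" and \<tau>: "\<tau> > 0" and r0: "r0 > 0" and a: "a = \<tau> * r0 powr \<beta>"
  shows "(\<integral>\<^sup>+z. ennreal (1 - 1 / (1 + a * norm z powr (- \<beta>))) * indicator {z. r0 \<le> norm z} z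
            \<partial>(lborel :: (real^2) measure)) =
         ennreal (pi * r0\<^sup>2 * (2 * \<tau> / (\<beta> - 2) *
           integral {0..1} (\<lambda>u. 1 / (1 + \<tau> * u powr (\<beta> / (\<beta> - 2))))))"
proof -
  define c where "c = \<beta> / (\<beta> - 2)"
  have c: "c > 0" using \<beta> by (simp add: c_def)
  let ?j = "\<lambda>u. 1 / (1 + \<tau> * u powr c)"
  define J where "J = (\<lambda>y. integral {0..y} ?j)"
  have pos: "1 + \<tau> * u powr p > 0" for u p using \<tau> by (intro add_pos_nonneg) auto
  \<comment> \<open>The interval reaches beyond 1 so that \<open>J\<close> has a two-sided
    derivative at 1, the value of u at r = r0.\<close>
  have cont: "continuous_on {0..2} ?j"
    using c pos by (intro continuous_intros continuous_on_powr') (auto simp: less_imp_neq[symmetric])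
  have J': "(J has_real_derivative ?j y) (at y)" if "0 < y" "y < 2" for y
  proof -
    have "(J has_real_derivative ?j y) (at y within {0..2})"
      unfolding J_def using cont that by (intro integral_has_real_derivative) auto
    then show ?thesis using that by (simp add: at_within_Icc_at)
  qed
  have J0: "(J \<longlongrightarrow> 0) (at_right 0)"
  proof -
    have "continuous_on {0..2} J"
      unfolding J_def using cont by (intro indefinite_integral_continuous_1 integrable_continuous_real)
    then have "(J \<longlongrightarrow> J 0) (at 0 within {0..2})" by (auto simp: continuous_on_def)
    then show ?thesis by (simp add: J_def at_within_Icc_at_right)
  qed
  \<comment> \<open>The substitution \<open>u = (r / r0) powr (2 - \<beta>)\<close>, written as an antiderivative.\<close>
  define C where "C = 2 * pi * r0\<^sup>2 * \<tau> / (\<beta> - 2)"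
  define F where "F = (\<lambda>r. - C * J ((r / r0) powr (2 - \<beta>)))"
  define f where "f = (\<lambda>r. 2 * pi * r * (1 - 1 / (1 + a * r powr (- \<beta>))))"
  have f': "DERIV F r :> f r" if r: "r0 \<le> r" for r
  proof -
    define q where "q = r / r0"
    have q: "q \<ge> 1" "q > 0" "r > 0" using r r0 by (auto simp: q_def)
    have le: "q powr (2 - \<beta>) \<le> 1" using q \<beta> powr_mono[of "2 - \<beta>" 0 q] by simp
    have qc: "(q powr (2 - \<beta>)) powr c = q powr (- \<beta>)"
    proof -
      have "(\<beta> - 2) * c = \<beta>" using \<beta> by (simp add: c_def)
      then have "(2 - \<beta>) * c = - \<beta>" by (simp add: algebra_simps)
      then show ?thesis by (simp add: powr_powr)
    qed
    have aq: "a * r powr (- \<beta>) = \<tau> * q powr (- \<beta>)"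
      using q r0 by (simp add: a q_def powr_divide powr_minus field_simps)
    have "DERIV (\<lambda>r. (r / r0) powr (2 - \<beta>)) r :> (2 - \<beta>) * q powr (1 - \<beta>) / r0"
      using q r0 by (auto intro!: derivative_eq_intros simp: q_def powr_diff field_simps power2_eq_square)
    moreover have "(J has_real_derivative ?j (q powr (2 - \<beta>))) (at (q powr (2 - \<beta>)))"
      using q le by (intro J') auto
    ultimately have "DERIV F r :> - C * (?j (q powr (2 - \<beta>)) * ((2 - \<beta>) * q powr (1 - \<beta>) / r0))"
      unfolding F_def q_def
      by (intro DERIV_cmult DERIV_chain2[where f = J])
    also have "- C * (?j (q powr (2 - \<beta>)) * ((2 - \<beta>) * q powr (1 - \<beta>) / r0)) = 
       2 * pi * r0 * \<tau> * q powr (1 - \<beta>) / (1 + \<tau> * q powr (- \<beta>))"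
      unfolding qc C_def using \<beta> r0 pos[of q "- \<beta>"] by (simp add: divide_simps power2_eq_square) algebra
    also have "\<dots> = f r"
    proof -
      have "q powr (1 - \<beta>) = q * q powr (- \<beta>)" using q by (simp add: powr_diff powr_minus field_simps)
      moreover have "r = q * r0" using r0 by (simp add: q_def)
      ultimately show ?thesis
        unfolding f_def aq using pos[of q "- \<beta>"] by (simp add: field_simps)
    qed
    finally show ?thesis .
  qed
  have a0: "a \<ge> 0" using \<tau> by (simp add: a)
  have fr: "1 / (1 + a * r powr (- \<beta>)) \<le> 1" for r using a0 by (simp add: add_pos_nonneg)
  have lim: "(F \<longlongrightarrow> 0) at_top"
  proof -
    have "filterlim (\<lambda>r. r / r0) at_top at_top"
      using r0 by (intro filterlim_at_top_mult_tendsto_pos[where c = "1 / r0" and f = "\<lambda>_. 1 / r0", simplified])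
         (auto intro: filterlim_ident)
    then have "((\<lambda>r. (r / r0) powr (2 - \<beta>)) \<longlongrightarrow> 0) at_top"
      using \<beta> by (intro tendsto_neg_powr) auto
    moreover have "eventually (\<lambda>r. (r / r0) powr (2 - \<beta>) \<in> {0<..}) at_top"
      using eventually_gt_at_top[of 0] by eventually_elim (use r0 in auto)
    ultimately have "filterlim (\<lambda>r. (r / r0) powr (2 - \<beta>)) (at_right 0) at_top"
      by (auto simp: filterlim_at elim: eventually_mono)
    from filterlim_compose[OF J0 this] have "((\<lambda>r. - C * J ((r / r0) powr (2 - \<beta>))) \<longlongrightarrow> - C * 0) at_top"
      by (intro tendsto_intros)
    then show ?thesis by (simp add: F_def)
  qed
  have "(\<integral>\<^sup>+z. ennreal (1 - 1 / (1 + a * norm z powr (- \<beta>))) * indicator {z. r0 \<le> norm z} z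
            \<partial>(lborel :: (real^2) measure)) =
        (\<integral>\<^sup>+z. ennreal (1 - 1 / (1 + a * norm z powr (- \<beta>))) * indicator {r0..} (norm z)
            \<partial>(lborel :: (real^2) measure))"
    by (intro nn_integral_cong) (auto split: split_indicator)
  also have "\<dots> = (\<integral>\<^sup>+r. ennreal (2 * pi * r) * indicator {0..} r *
      (ennreal (1 - 1 / (1 + a * r powr (- \<beta>))) * indicator {r0..} r) \<partial>lborel)"
    by (rule nn_integral_radial) measurable
  also have "\<dots> = (\<integral>\<^sup>+r. ennreal (f r) * indicator {r0..} r \<partial>lborel)"
    using r0 fr by (intro nn_integral_cong)
      (auto split: split_indicator simp: f_def ennreal_mult)
  also have "\<dots> = ennreal (0 - F r0)"
    using fr r0 by (intro nn_integral_FTC_atLeast f' lim) (auto simp: f_def)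
  also have "0 - F r0 = pi * r0\<^sup>2 * (2 * \<tau> / (\<beta> - 2) * integral {0..1} ?j)"
    using r0 \<beta> by (simp add: F_def C_def J_def)
  finally show ?thesis unfolding c_def .
qed

section \<open>The Laplace functional of a Poisson point process\<close>

text \<open>This includes y = \<open>\<top>\<close>, n = 0, where \<top> * 0 = 0 agrees with 0 ^ 0 =
  1.\<close>

lemma nexp_mult_of_nat: "nexp (y * of_nat n) = nexp y ^ n"
  by (induction n) (auto simp: nexp_add distrib_left)

text \<open>The Poisson generating function exp (m * (t - 1)) at t = \<open>nexp y\<close>. The
  point probabilities already add up to 1, so the \<open>ennreal\<close>-valued count is almost
  surely a finite integer.\<close>

lemma (in prob_space) expectation_nexp_poisson:
  fixes N :: "'a \<Rightarrow> ennreal"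
  assumes [measurable]: "N \<in> borel_measurable M" and m: "0 \<le> m"
    and pois: "\<And>n. prob {\<omega>\<in>space M. N \<omega> = of_nat n} = exp (- m) * m ^ n / fact n"
  shows "expectation (\<lambda>\<omega>. nexp (y * N \<omega>)) = exp (- (m * (1 - nexp y)))"
proof -
  define A where "A n = {\<omega>\<in>space M. N \<omega> = of_nat n}" for n :: nat
  have A [measurable]: "A n \<in> events" for n unfolding A_def by measurable
  have disj: "disjoint_family A" by (auto simp: A_def disjoint_family_on_def)
  have exps: "(\<lambda>n. exp (- m) * x ^ n / fact n) sums (exp (- m) * exp x)" for x :: real
    using sums_mult[OF exp_converges[of x], of "exp (- m)"] by (simp add: field_simps)
  have "(\<lambda>n. prob (A n)) sums prob (\<Union>n. A n)"
    using disj A by (intro finite_measure_UNION) auto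
  moreover have "(\<lambda>n. prob (A n)) sums 1"
    using exps[of m] pois by (simp add: A_def flip: exp_add)
  ultimately have "prob (\<Union>n. A n) = 1" by (rule sums_unique2)
  then have ae: "AE \<omega> in M. \<omega> \<in> (\<Union>n. A n)"
    using A by (intro AE_prob_1) auto
  have "(\<integral>\<^sup>+\<omega>. ennreal (nexp (y * N \<omega>)) \<partial>M) =
      (\<integral>\<^sup>+\<omega>. (\<Sum>n. ennreal (nexp y ^ n) * indicator (A n) \<omega>) \<partial>M)"
  proof (rule nn_integral_cong_AE, use ae in eventually_elim)
    case (elim \<omega>)
    then obtain n where n: "\<omega> \<in> A n" by auto
    then have "(\<Sum>n. ennreal (nexp y ^ n) * indicator (A n) \<omega>) = ennreal (nexp y ^ n)"
      using disj by (intro suminf_cmult_indicator) auto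
    with n show ?case by (simp add: A_def nexp_mult_of_nat)
  qed
  also have "\<dots> = (\<Sum>n. ennreal (nexp y ^ n) * emeasure M (A n))"
    by (subst nn_integral_suminf) (auto simp: nn_integral_cmult_indicator)
  also have "\<dots> = (\<Sum>n. ennreal (exp (- m) * (m * nexp y) ^ n / fact n))"
    using pois m by (intro suminf_cong)
      (simp add: emeasure_eq_measure A_def power_mult_distrib mult_ac flip: ennreal_mult)
  also have "\<dots> = ennreal (exp (- m) * exp (m * nexp y))"
    using exps m by (intro suminf_ennreal_eq) auto
  finally have "expectation (\<lambda>\<omega>. nexp (y * N \<omega>)) = exp (- m) * exp (m * nexp y)"
    by (simp add: integral_eq_nn_integral)
  then show ?thesis by (simp add: algebra_simps flip: exp_add)
qed

text \<open>Points are grouped by the value of f at them, so the sum depends on the enumeration only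
  through the counts of the level sets.\<close>

lemma suminf_simple_point_count:
  fixes f :: "real^2 \<Rightarrow> ennreal"
  assumes "finite (range f)"
  shows "(\<Sum>k. f (Y k \<omega>)) = (\<Sum>y\<in>range f. y * point_count Y (f -` {y}) \<omega>)"
proof -
  have *: "f z = (\<Sum>y\<in>range f. y * indicator (f -` {y}) z)" for z
  proof -
    have "(\<Sum>y\<in>range f. y * indicator (f -` {y}) z) = (\<Sum>y\<in>{f z}. y * indicator (f -` {y}) z)"
      using assms by (intro sum.mono_neutral_right) (auto simp: indicator_def)
    then show ?thesis by simp
  qed
  have "(\<Sum>k. f (Y k \<omega>)) = (\<Sum>k. \<Sum>y\<in>range f. y * indicator (f -` {y}) (Y k \<omega>))"
    by (intro suminf_cong *)
  also have "\<dots> = (\<Sum>y\<in>range f. \<Sum>k. y * indicator (f -` {y}) (Y k \<omega>))"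
    by (intro suminf_sum summableI)
  finally show ?thesis unfolding point_count_def by simp
qed

lemma measurable_point_count [measurable]:
  assumes [measurable]: "\<And>k. Y k \<in> borel_measurable M" "A \<in> sets borel"
  shows "point_count Y A \<in> borel_measurable M"
  unfolding point_count_def by measurable

text \<open>The level sets of the nonzero values are disjoint, so their counts are independent
  Poisson variables and the expectation is a product of Poisson transforms. The exponents add up to
  the integral of the simple function 1 - \<open>nexp\<close> of f.\<close>

lemma ppp_laplace_simple:
  fixes f :: "real^2 \<Rightarrow> ennreal"
  assumes M: "prob_space M" and ppp: "homogeneous_ppp M \<mu> D Y" and mu: "0 \<le> \<mu>"
    and f: "simple_function borel f" and supp: "\<And>z. z \<notin> D \<Longrightarrow> f z = 0"
    and fin: "emeasure lborel {z. f z \<noteq> 0} < \<infinity>"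
  shows "(\<integral>\<omega>. nexp (\<Sum>k. f (Y k \<omega>)) \<partial>M) =
           nexp (ennreal \<mu> * (\<integral>\<^sup>+z. ennreal (1 - nexp (f z)) \<partial>lborel))"
proof -
  interpret prob_space M by fact
  have finR: "finite (range f)" using f by (auto simp: simple_function_def)
  have fm [measurable]: "f \<in> borel_measurable borel" using f by (rule borel_measurable_simple_function)
  have Ym [measurable]: "Y k \<in> borel_measurable M" for k using ppp by (auto simp: homogeneous_ppp_def)
  define n where "n = card (range f - {0})"
  \<comment> \<open>Independence of counts is stated for families indexed by an initial segment. The
    value 0 is left out because its level set need neither lie in \<open>D\<close> nor have finite
    area.\<close>
  obtain e where e: "bij_betw e {..<n} (range f - {0})"
    unfolding n_def using ex_bij_betw_nat_finite[of "range f - {0}"] finR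
    by (auto simp: atLeast0LessThan)
  have e0: "e l \<noteq> 0" if "l < n" for l using e that by (auto simp: bij_betw_def)
  define B where "B l = f -` {e l}" for l
  have Bm [measurable]: "B l \<in> sets borel" for l
    using measurable_sets[OF fm, of "{e l}"] by (simp add: B_def)
  have BD: "B l \<subseteq> D" if "l < n" for l using e0[OF that] supp by (force simp: B_def)
  have Bfin: "emeasure lborel (B l) < \<infinity>" if "l < n" for l
  proof -
    have "emeasure lborel (B l) \<le> emeasure lborel {z. f z \<noteq> 0}"
      using e0[OF that] by (intro emeasure_mono) (auto simp: B_def)
    with fin show ?thesis by simp
  qed
  have disjB: "disjoint_family_on B {..<n}"
    using e by (auto simp: disjoint_family_on_def B_def bij_betw_def dest: inj_onD)
  have reindex: "(\<Sum>y\<in>range f. F y) = (\<Sum>l<n. F (e l))" if "F 0 = 0" for F :: "ennreal \<Rightarrow> ennreal"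
  proof -
    have "(\<Sum>y\<in>range f. F y) = (\<Sum>y\<in>range f - {0}. F y)"
      using finR that by (intro sum.mono_neutral_right) auto
    also have "\<dots> = (\<Sum>l<n. F (e l))"
      by (rule sum.reindex_bij_betw[OF e, symmetric])
    finally show ?thesis .
  qed
  have count: "(\<Sum>k. f (Y k \<omega>)) = (\<Sum>l<n. e l * point_count Y (B l) \<omega>)" for \<omega>
    unfolding suminf_simple_point_count[OF finR] B_def by (rule reindex) simp
  have val: "ennreal (1 - nexp (f z)) = (\<Sum>l<n. ennreal (1 - nexp (e l)) * indicator (B l) z)" for z
  proof -
    have "(\<Sum>y\<in>range f. ennreal (1 - nexp y) * indicator (f -` {y}) z) =
        (\<Sum>y\<in>{f z}. ennreal (1 - nexp y) * indicator (f -` {y}) z)"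
      using finR by (intro sum.mono_neutral_right) (auto simp: indicator_def)
    moreover have "(\<Sum>y\<in>range f. ennreal (1 - nexp y) * indicator (f -` {y}) z) =
        (\<Sum>l<n. ennreal (1 - nexp (e l)) * indicator (B l) z)"
      unfolding B_def by (rule reindex) simp
    ultimately show ?thesis by simp
  qed
  have indep: "indep_vars (\<lambda>_. borel) (\<lambda>l. point_count Y (B l)) {..<n}"
    using ppp[unfolded homogeneous_ppp_def, THEN conjunct2, THEN conjunct2, THEN conjunct2, rule_format, of n B]
      BD disjB Bm by simp
  have pois: "expectation (\<lambda>\<omega>. nexp (e l * point_count Y (B l) \<omega>)) =
      exp (- (\<mu> * measure lborel (B l) * (1 - nexp (e l))))" if l: "l < n" for l
    using ppp[unfolded homogeneous_ppp_def, THEN conjunct2, THEN conjunct2, THEN conjunct1, rule_format, of "B l"]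
      mu BD[OF l] Bfin[OF l] Bm by (intro expectation_nexp_poisson) simp_all
  have "(\<integral>\<omega>. nexp (\<Sum>k. f (Y k \<omega>)) \<partial>M) =
      (\<integral>\<omega>. (\<Prod>l<n. nexp (e l * point_count Y (B l) \<omega>)) \<partial>M)"
    by (simp add: count nexp_sum)
  also have "\<dots> = (\<Prod>l<n. expectation (\<lambda>\<omega>. nexp (e l * point_count Y (B l) \<omega>)))"
  proof (rule indep_vars_lebesgue_integral)
    show "indep_vars (\<lambda>_. borel) (\<lambda>l \<omega>. nexp (e l * point_count Y (B l) \<omega>)) {..<n}"
      using indep by (rule indep_vars_compose2) measurable
    show "integrable M (\<lambda>\<omega>. nexp (e l * point_count Y (B l) \<omega>))" for l
      by (rule integrable_const_bound[where B = 1]) auto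
  qed simp
  also have "\<dots> = (\<Prod>l<n. nexp (ennreal \<mu> * (ennreal (1 - nexp (e l)) * emeasure lborel (B l))))"
  proof (rule prod.cong[OF refl])
    fix l assume "l \<in> {..<n}"
    then have "emeasure lborel (B l) = ennreal (measure lborel (B l))" 
      using Bfin[of l] by (intro emeasure_eq_ennreal_measure) auto
    then show "expectation (\<lambda>\<omega>. nexp (e l * point_count Y (B l) \<omega>)) =
        nexp (ennreal \<mu> * (ennreal (1 - nexp (e l)) * emeasure lborel (B l)))"
      using \<open>l \<in> {..<n}\<close> mu by (simp add: pois mult_ac flip: ennreal_mult)
  qed
  also have "\<dots> = nexp (ennreal \<mu> * (\<integral>\<^sup>+z. ennreal (1 - nexp (f z)) \<partial>lborel))"
  proof -
    have "(\<integral>\<^sup>+z. ennreal (1 - nexp (f z)) \<partial>lborel) =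
        (\<Sum>l<n. \<integral>\<^sup>+z. ennreal (1 - nexp (e l)) * indicator (B l) z \<partial>lborel)"
      unfolding val by (intro nn_integral_sum) measurable
    also have "\<dots> = (\<Sum>l<n. ennreal (1 - nexp (e l)) * emeasure lborel (B l))"
      by (intro sum.cong refl nn_integral_cmult_indicator) simp
    finally show ?thesis by (simp add: nexp_sum sum_distrib_left)
  qed
  finally show ?thesis .
qed

text \<open>Both sides of the simple case pass to the limit along an increasing approximation: the
  left by dominated convergence with bound 1, the right by monotone convergence, as 1 -
  \<open>nexp\<close> is increasing.\<close>

theorem ppp_laplace:
  fixes f :: "real^2 \<Rightarrow> ennreal"
  assumes M: "prob_space M" and ppp: "homogeneous_ppp M \<mu> D Y" and mu: "0 \<le> \<mu>"
    and [measurable]: "f \<in> borel_measurable borel" and supp: "\<And>z. z \<notin> D \<Longrightarrow> f z = 0"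
  shows "(\<integral>\<omega>. nexp (\<Sum>k. f (Y k \<omega>)) \<partial>M) =
           nexp (ennreal \<mu> * (\<integral>\<^sup>+z. ennreal (1 - nexp (f z)) \<partial>lborel))"
proof -
  interpret prob_space M by fact
  have [measurable]: "Y k \<in> borel_measurable M" for k using ppp by (auto simp: homogeneous_ppp_def)
  obtain F where F: "\<And>i. simple_function borel (F i)" "incseq F" "\<And>z. (SUP i. F i z) = f z"
    using borel_measurable_implies_simple_function_sequence'[OF assms(4)] by metis
  \<comment> \<open>The balls make the level sets have finite area, as the Poisson counts require.\<close>
  define G where "G n z = F n z * indicator (cball 0 (real n)) z" for n z
  have G: "simple_function borel (G n)" for n
    unfolding G_def using F(1) by (intro simple_function_mult simple_function_indicator) auto
  have Gm [measurable]: "G n \<in> borel_measurable borel" for n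
    using G by (rule borel_measurable_simple_function)
  have incG: "incseq G"
    using F(2) unfolding G_def incseq_def le_fun_def
    by (auto intro!: mult_mono split: split_indicator)
  have limG: "(\<lambda>n. G n z) \<longlonglongrightarrow> f z" for z
  proof -
    have "(\<lambda>n. F n z) \<longlonglongrightarrow> f z"
      using F(2) LIMSEQ_SUP[of "\<lambda>n. F n z"] by (auto simp: F(3) incseq_def le_fun_def)
    moreover have "eventually (\<lambda>n. F n z = G n z) sequentially"
      using eventually_ge_at_top[of "nat \<lceil>norm z\<rceil>"]
      by eventually_elim (auto simp: G_def indicator_def dist_norm nat_le_iff ceiling_le_iff)
    ultimately show ?thesis by (rule Lim_transform_eventually)
  qed
  have G_le: "G n z \<le> f z" for n z
    using incG by (intro incseq_le[OF _ limG]) (auto simp: incseq_def le_fun_def)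
  have eq: "(\<integral>\<omega>. nexp (\<Sum>k. G n (Y k \<omega>)) \<partial>M) =
      nexp (ennreal \<mu> * (\<integral>\<^sup>+z. ennreal (1 - nexp (G n z)) \<partial>lborel))" for n
  proof (rule ppp_laplace_simple[OF M ppp mu G])
    show "G n z = 0" if "z \<notin> D" for z
      using G_le[of n z] supp[OF that] by simp
    have "emeasure lborel {z. G n z \<noteq> 0} \<le> emeasure lborel (cball (0::real^2) (real n))"
      by (intro emeasure_mono) (auto simp: G_def split: split_indicator_asm)
    then show "emeasure lborel {z. G n z \<noteq> 0} < \<infinity>"
      by (auto simp: emeasure_cball intro: le_less_trans)
  qed
  have lim1: "(\<lambda>n. \<integral>\<omega>. nexp (\<Sum>k. G n (Y k \<omega>)) \<partial>M) \<longlonglongrightarrow> (\<integral>\<omega>. nexp (\<Sum>k. f (Y k \<omega>)) \<partial>M)"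
  proof (rule integral_dominated_convergence[where w = "\<lambda>_. 1"])
    have "(\<lambda>n. \<Sum>k. G n (Y k \<omega>)) \<longlonglongrightarrow> (\<Sum>k. f (Y k \<omega>))" for \<omega>
      unfolding nn_integral_count_space_nat[symmetric]
      using incG limG by (intro nn_integral_LIMSEQ) (auto simp: incseq_def le_fun_def)
    then show "AE \<omega> in M. (\<lambda>n. nexp (\<Sum>k. G n (Y k \<omega>))) \<longlonglongrightarrow> nexp (\<Sum>k. f (Y k \<omega>))"
      by (intro AE_I2 tendsto_nexp)
  qed auto
  have lim2: "(\<lambda>n. nexp (ennreal \<mu> * (\<integral>\<^sup>+z. ennreal (1 - nexp (G n z)) \<partial>lborel)))
      \<longlonglongrightarrow> nexp (ennreal \<mu> * (\<integral>\<^sup>+z. ennreal (1 - nexp (f z)) \<partial>lborel))"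
    using incG by (intro tendsto_nexp ennreal_tendsto_cmult nn_integral_LIMSEQ tendsto_ennrealI
        tendsto_intros limG) (auto simp: incseq_def le_fun_def intro!: ennreal_leI nexp_antimono)
  show ?thesis
    using LIMSEQ_unique[OF lim1[unfolded eq] lim2] .
qed

text \<open>
  The tiers are independent only as counting measures, so the sum over the points has to be
  recovered measurably from the counts.
\<close>

lemma suminf_point_process_factorization:
  fixes f :: "real^2 \<Rightarrow> ennreal"
  assumes "f \<in> borel_measurable borel"
  obtains \<Phi> where "\<Phi> \<in> borel_measurable (PiM (sets borel) (\<lambda>_. borel))"
    "\<And>Y (\<omega>::'a). (\<Sum>k. f (Y k \<omega>)) = \<Phi> (\<lambda>A\<in>sets borel. point_count Y A \<omega>)"
proof -
  obtain F where F: "\<And>i. simple_function borel (F i)" "incseq F" "\<And>z. (SUP i. F i z) = f z"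
    using borel_measurable_implies_simple_function_sequence'[OF assms] by metis
  have fin: "finite (range (F n))" for n using F(1) by (auto simp: simple_function_def)
  have sets: "F n -` {y} \<in> sets borel" for n y
    using measurable_sets[OF borel_measurable_simple_function[OF F(1)], of "{y}" n] by simp
  \<comment> \<open>This is the integral of f against the counting measure \<nu>, written so that
    only countably many coordinates of \<nu> enter; that makes it measurable on the uncountable
    product.\<close>
  define \<Phi> where "\<Phi> = (\<lambda>\<nu>. SUP n. \<Sum>y\<in>range (F n). y * \<nu> (F n -` {y}))"
  show ?thesis
  proof
    show "\<Phi> \<in> borel_measurable (PiM (sets borel) (\<lambda>_. borel))"
      unfolding \<Phi>_def using sets
      by (intro borel_measurable_SUP borel_measurable_sum borel_measurable_times_ennreal
          measurable_component_singleton) auto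
    fix Y :: "nat \<Rightarrow> 'a \<Rightarrow> real^2" and \<omega>
    have "(\<Sum>k. f (Y k \<omega>)) = (\<integral>\<^sup>+k. (SUP n. F n (Y k \<omega>)) \<partial>count_space UNIV)"
      by (simp add: nn_integral_count_space_nat F(3))
    also have "\<dots> = (SUP n. \<Sum>k. F n (Y k \<omega>))"
      using F(2) by (subst nn_integral_monotone_convergence_SUP)
        (auto simp: nn_integral_count_space_nat incseq_def le_fun_def)
    also have "\<dots> = \<Phi> (\<lambda>A\<in>sets borel. point_count Y A \<omega>)"
      using sets by (simp add: \<Phi>_def suminf_simple_point_count[OF fin])
    finally show "(\<Sum>k. f (Y k \<omega>)) = \<Phi> (\<lambda>A\<in>sets borel. point_count Y A \<omega>)" .
  qed
qed

section \<open>Outage for fixed interferer positions\<close>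

text \<open>Independence makes the joint law a product measure, so Fubini applies. The second copy
  \<omega>' keeps Y frozen while X is averaged; for gains and positions this is conditioning on the
  positions.\<close>

lemma (in prob_space) indep_set_nn_integral:
  assumes X [measurable]: "random_variable S X" and Y [measurable]: "random_variable T Y"
    and ind: "indep_set (sets (vimage_algebra (space M) X S)) (sets (vimage_algebra (space M) Y T))"
    and F [measurable]: "F \<in> borel_measurable (S \<Otimes>\<^sub>M T)"
  shows "(\<integral>\<^sup>+\<omega>. F (X \<omega>, Y \<omega>) \<partial>M) = (\<integral>\<^sup>+\<omega>'. \<integral>\<^sup>+\<omega>. F (X \<omega>, Y \<omega>') \<partial>M \<partial>M)"
proof -
  interpret X: prob_space "distr M S X" by (rule prob_space_distr) measurable
  interpret Y: prob_space "distr M T Y" by (rule prob_space_distr) measurable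
  interpret XY: pair_sigma_finite "distr M S X" "distr M T Y" ..
  have joint: "distr M S X \<Otimes>\<^sub>M distr M T Y = distr M (S \<Otimes>\<^sub>M T) (\<lambda>\<omega>. (X \<omega>, Y \<omega>))"
  proof (rule pair_measure_eqI)
    show "sigma_finite_measure (distr M S X)" "sigma_finite_measure (distr M T Y)" by unfold_locales
    fix A B assume "A \<in> sets (distr M S X)" "B \<in> sets (distr M T Y)"
    then have AB [measurable]: "A \<in> sets S" "B \<in> sets T" by auto
    have "prob ((X -` A \<inter> space M) \<inter> (Y -` B \<inter> space M)) =
        prob (X -` A \<inter> space M) * prob (Y -` B \<inter> space M)"
      using AB by (intro indep_setD[OF ind] in_vimage_algebra)
    moreover have "(\<lambda>\<omega>. (X \<omega>, Y \<omega>)) -` (A \<times> B) \<inter> space M =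
        (X -` A \<inter> space M) \<inter> (Y -` B \<inter> space M)" by auto
    ultimately show "emeasure (distr M S X) A * emeasure (distr M T Y) B =
        emeasure (distr M (S \<Otimes>\<^sub>M T) (\<lambda>\<omega>. (X \<omega>, Y \<omega>))) (A \<times> B)"
      by (simp add: emeasure_distr emeasure_eq_measure flip: ennreal_mult)
  qed simp
  have "(\<integral>\<^sup>+\<omega>. F (X \<omega>, Y \<omega>) \<partial>M) = (\<integral>\<^sup>+p. F p \<partial>distr M (S \<Otimes>\<^sub>M T) (\<lambda>\<omega>. (X \<omega>, Y \<omega>)))"
    by (simp add: nn_integral_distr)
  also have "\<dots> = (\<integral>\<^sup>+y. \<integral>\<^sup>+x. F (x, y) \<partial>distr M S X \<partial>distr M T Y)"
    unfolding joint[symmetric] by (rule XY.nn_integral_snd[symmetric]) measurable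
  also have "\<dots> = (\<integral>\<^sup>+\<omega>'. \<integral>\<^sup>+x. F (x, Y \<omega>') \<partial>distr M S X \<partial>M)"
    by (rule nn_integral_distr) measurable
  also have "\<dots> = (\<integral>\<^sup>+\<omega>'. \<integral>\<^sup>+\<omega>. F (X \<omega>, Y \<omega>') \<partial>M \<partial>M)"
    by (intro nn_integral_cong nn_integral_distr) (use measurable_space[of Y M T] in measurable)
  finally show ?thesis .
qed

lemma (in prob_space) indep_var_nn_integral:
  assumes "indep_var S X T Y" and "F \<in> borel_measurable (S \<Otimes>\<^sub>M T)"
  shows "(\<integral>\<^sup>+\<omega>. F (X \<omega>, Y \<omega>) \<partial>M) = (\<integral>\<^sup>+\<omega>'. \<integral>\<^sup>+\<omega>. F (X \<omega>, Y \<omega>') \<partial>M \<partial>M)"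
  using assms(1) unfolding indep_var_eq sets_vimage_algebra[symmetric]
  by (elim conjE) (rule indep_set_nn_integral[OF _ _ _ assms(2)])

lemma emeasure_eq_nn_integral_indicator:
  assumes "{\<omega>\<in>space M. X \<omega> \<in> A} \<in> sets M"
  shows "emeasure M {\<omega>\<in>space M. X \<omega> \<in> A} = (\<integral>\<^sup>+\<omega>. indicator A (X \<omega>) \<partial>M)"
proof -
  have "emeasure M {\<omega>\<in>space M. X \<omega> \<in> A} = (\<integral>\<^sup>+\<omega>. indicator {\<omega>\<in>space M. X \<omega> \<in> A} \<omega> \<partial>M)"
    using assms by simp
  also have "\<dots> = (\<integral>\<^sup>+\<omega>. indicator A (X \<omega>) \<partial>M)"
    by (intro nn_integral_cong) (auto split: split_indicator)
  finally show ?thesis .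
qed

lemma (in prob_space) prob_gt_exponential:
  assumes "distributed M lborel X (\<lambda>t. ennreal (exponential_density 1 t))"
  shows "prob {\<omega>\<in>space M. T < ennreal (X \<omega>)} = nexp T"
proof (cases T)
  case (real r)
  then have "{\<omega>\<in>space M. T < ennreal (X \<omega>)} = {\<omega>\<in>space M. r < X \<omega>}"
    by (auto simp: ennreal_less_iff)
  then show ?thesis
    using exponential_distributedD_gt[of X 1 r] assms real by simp
qed simp

lemma (in prob_space) expectation_nexp_exponential:
  assumes X: "distributed M lborel X (\<lambda>t. ennreal (exponential_density 1 t))" and a: "0 \<le> a"
  shows "expectation (\<lambda>\<omega>. nexp (ennreal (a * X \<omega>))) = 1 / (1 + a)"
proof -
  have [measurable]: "X \<in> borel_measurable M" using distributed_measurable[OF X] by simp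
  have "(\<integral>\<^sup>+\<omega>. ennreal (nexp (ennreal (a * X \<omega>))) \<partial>M) =
      (\<integral>\<^sup>+t. ennreal (exponential_density 1 t) * ennreal (nexp (ennreal (a * t))) \<partial>lborel)"
    by (rule distributed_nn_integral[OF X, symmetric]) measurable
  also have "\<dots> = (\<integral>\<^sup>+t. ennreal (exp (- ((1 + a) * t))) * indicator {0..} t \<partial>lborel)"
    using a by (intro nn_integral_cong)
      (auto simp: exponential_density_def algebra_simps simp flip: ennreal_mult exp_add split: split_indicator)
  also have "\<dots> = ennreal (0 - (- exp (- ((1 + a) * 0)) / (1 + a)))"
  proof (rule nn_integral_FTC_atLeast)
    have "((\<lambda>t. exp (- ((1 + a) * t))) \<longlongrightarrow> 0) at_top"
      using a by (intro filterlim_compose[OF exp_at_bot] filterlim_uminus_at_top[THEN iffD1]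
        filterlim_tendsto_pos_mult_at_top[OF tendsto_const _ filterlim_ident]) auto
    from tendsto_divide[OF tendsto_minus[OF this] tendsto_const[of "1 + a"]] a
    show "((\<lambda>t. - exp (- ((1 + a) * t)) / (1 + a)) \<longlongrightarrow> 0) at_top" by simp
    have "1 + a \<noteq> 0" using a by simp
    then show "((\<lambda>t. - exp (- ((1 + a) * t)) / (1 + a)) has_real_derivative exp (- ((1 + a) * t))) (at t)" for t
      by (auto intro!: derivative_eq_intros simp: divide_simps) (simp add: algebra_simps)
  qed auto
  finally show ?thesis using a by (simp add: integral_eq_nn_integral)
qed

text \<open>The equivalence survives the degenerate denominators: for D = 0 the quotient is
  \<open>\<top>\<close> if x > 0 and 0 otherwise, and for D = \<open>\<top>\<close> both sides are
  true. These are the cases of no noise and interference, and of infinite interference.\<close>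

lemma ennreal_divide_le_iff:
  assumes w: "0 < w" and t: "0 < t"
  shows "ennreal (w * x) / D \<le> ennreal t \<longleftrightarrow> ennreal x \<le> ennreal (t / w) * D"
proof (cases D)
  case (real d)
  show ?thesis
  proof (cases "d = 0")
    case True
    then show ?thesis
      using real w t by (cases "x \<le> 0") (auto simp: ennreal_neg mult_nonneg_nonpos
        ennreal_divide_eq_top_iff top_unique ennreal_divide_zero not_le divide_ennreal_def)
  next
    case False
    then show ?thesis
      using real w t by (cases "x \<le> 0")
        (auto simp: ennreal_neg mult_nonneg_nonpos divide_ennreal field_simps simp flip: ennreal_mult)
  qed
qed (use w t in \<open>auto simp: ennreal_mult_top\<close>)

text \<open>Given the interferers' gains, the serving gain exceeds the threshold \<open>T\<close>
  with probability \<open>nexp T\<close>, so success has probability E[\<open>nexp T\<close>]. Each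
  independent interferer's gain then contributes 1 / (1 + s * c j k), recorded as
  \<open>nexp\<close> of a logarithm.\<close>

lemma (in prob_space) outage_fixed_positions:
  assumes dist: "\<And>p. p \<in> gain_index \<Longrightarrow>
      distributed M lborel (gain_family g h p) (\<lambda>t. ennreal (exponential_density 1 t))"
    and ind: "indep_vars (\<lambda>_. borel) (gain_family g h) gain_index"
    and w: "0 < w" and t: "0 < t" and c: "\<And>j k. 0 \<le> c j k" and N: "0 \<le> N"
  shows "prob {\<omega>\<in>space M. ennreal (w * g \<omega>) /
      ((\<Sum>j=1..3. \<Sum>k. ennreal (c j k * h j k \<omega>)) + ennreal N) \<le> ennreal t} =
    1 - exp (- (t / w * N)) * (\<Prod>j=1..3. nexp (\<Sum>k. ennreal (ln (1 + t / w * c j k))))"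
proof -
  define s where "s = t / w"
  have s: "0 < s" using w t by (simp add: s_def)
  define T where "T = (\<lambda>\<omega>. ennreal s * ((\<Sum>j=1..3. \<Sum>k. ennreal (c j k * h j k \<omega>)) + ennreal N))"
  have in_idx: "None \<in> gain_index" "j \<in> {1..3} \<Longrightarrow> Some (j, k) \<in> gain_index" for j k
    by (auto simp: gain_index_def)
  have gd: "distributed M lborel g (\<lambda>t. ennreal (exponential_density 1 t))"
    using dist[OF in_idx(1)] by (simp add: gain_family_def)
  have hd: "distributed M lborel (h j k) (\<lambda>t. ennreal (exponential_density 1 t))" if "j \<in> {1..3}" for j k
    using dist[OF in_idx(2)[OF that]] by (simp add: gain_family_def)
  have gm [measurable]: "g \<in> borel_measurable M"
    using distributed_measurable[OF gd] by simp
  have hm [measurable]: "h j k \<in> borel_measurable M" if "j \<in> {1..3}" for j k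
    using distributed_measurable[OF hd[OF that]] by simp
  have Tm [measurable]: "T \<in> borel_measurable M" unfolding T_def by measurable

  let ?B = "Some ` ({1..3::nat} \<times> (UNIV :: nat set))"
  have iv: "indep_var (PiM {None} (\<lambda>_. borel)) (\<lambda>\<omega>. \<lambda>p\<in>{None}. gain_family g h p \<omega>)
     (PiM ?B (\<lambda>_. borel)) (\<lambda>\<omega>. \<lambda>p\<in>?B. gain_family g h p \<omega>)"
    using ind by (rule indep_var_restrict) (auto simp: gain_index_def)
  \<comment> \<open>The threshold as a function of the interferers' gains alone, a block independent
    of the serving gain.\<close>
  define T' where "T' = (\<lambda>b :: (nat \<times> nat) option \<Rightarrow> real.
      ennreal s * ((\<Sum>j=1..3. \<Sum>k. ennreal (c j k * b (Some (j, k)))) + ennreal N))"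
  have T'm [measurable]: "T' \<in> borel_measurable (PiM ?B (\<lambda>_. borel))"
  proof -
    have [measurable]: "(\<lambda>b. b (Some (j, k))) \<in> borel_measurable (PiM ?B (\<lambda>_. borel :: real measure))"
      if "j \<in> {1..3}" for j k using that by (intro measurable_component_singleton) auto
    show ?thesis unfolding T'_def by measurable
  qed
  have T'_eq: "T' (\<lambda>p\<in>?B. gain_family g h p \<omega>) = T \<omega>" for \<omega>
    unfolding T'_def T_def by (intro arg_cong2[where f = "(*)"] arg_cong2[where f = "(+)"] sum.cong
       refl suminf_cong) (auto simp: gain_family_def)
  have [measurable]: "(\<lambda>a. a None) \<in> borel_measurable (PiM {None :: (nat \<times> nat) option} (\<lambda>_. borel :: real measure))"
    by (intro measurable_component_singleton) auto
  have "emeasure M {\<omega>\<in>space M. T \<omega> < ennreal (g \<omega>)} = (\<integral>\<^sup>+\<omega>. indicator {x. snd x < fst x} (ennreal (g \<omega>), T \<omega>) \<partial>M)"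
    using emeasure_eq_nn_integral_indicator[of M "\<lambda>\<omega>. (ennreal (g \<omega>), T \<omega>)" "{x. snd x < fst x}"]
    by simp
  also have "\<dots> = (\<integral>\<^sup>+\<omega>. (\<lambda>(a, b). indicator {x. snd x < fst x} (ennreal (a None), T' b))
      (\<lambda>p\<in>{None}. gain_family g h p \<omega>, \<lambda>p\<in>?B. gain_family g h p \<omega>) \<partial>M)"
    by (simp only: T'_eq prod.case) (simp add: gain_family_def)
  also have "\<dots> = (\<integral>\<^sup>+\<omega>'. \<integral>\<^sup>+\<omega>. (\<lambda>(a, b). indicator {x. snd x < fst x} (ennreal (a None), T' b))
      (\<lambda>p\<in>{None}. gain_family g h p \<omega>, \<lambda>p\<in>?B. gain_family g h p \<omega>') \<partial>M \<partial>M)"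
    by (rule indep_var_nn_integral[OF iv]) measurable
  also have "\<dots> = (\<integral>\<^sup>+\<omega>'. \<integral>\<^sup>+\<omega>. indicator {x. snd x < fst x} (ennreal (g \<omega>), T \<omega>') \<partial>M \<partial>M)"
    by (simp only: T'_eq prod.case) (simp add: gain_family_def)
  also have "\<dots> = (\<integral>\<^sup>+\<omega>'. emeasure M {\<omega>\<in>space M. T \<omega>' < ennreal (g \<omega>)} \<partial>M)"
    using emeasure_eq_nn_integral_indicator[of M "\<lambda>\<omega>. (ennreal (g \<omega>), T _)" "{x. snd x < fst x}"]
    by simp
  also have "\<dots> = (\<integral>\<^sup>+\<omega>'. ennreal (nexp (T \<omega>')) \<partial>M)"
    by (simp add: emeasure_eq_measure prob_gt_exponential[OF gd])
  finally have gt: "prob {\<omega>\<in>space M. T \<omega> < ennreal (g \<omega>)} = expectation (\<lambda>\<omega>. nexp (T \<omega>))"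
    by (simp add: integral_eq_nn_integral measure_def)

  \<comment> \<open>Each tier is cut at its first n interferers, so that the expectation factors
    over a finite index set before n tends to infinity.\<close>
  define S where "S = (\<lambda>n \<omega>. ennreal s * ((\<Sum>j=1..3. \<Sum>k<n. ennreal (c j k * h j k \<omega>)) + ennreal N))"
  define L where "L = (\<lambda>n. exp (- (s * N)) * (\<Prod>j=1..3. nexp (\<Sum>k<n. ennreal (ln (1 + s * c j k)))))"
  have ln_nonneg: "0 \<le> ln (1 + s * c j k)" for j k using s c[of j k] by (intro ln_ge_zero) simp
  have ES: "expectation (\<lambda>\<omega>. nexp (S n \<omega>)) = L n" for n
  proof -
    let ?J = "Some ` ({1..3::nat} \<times> {..<n})"
    \<comment> \<open>The weight 0 for \<open>None\<close> is a dummy: the serving link is not in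
      \<open>?J\<close>.\<close>
    define u where "u = (\<lambda>p \<omega>. nexp (ennreal (s * (case p of None \<Rightarrow> 0 | Some (j, k) \<Rightarrow> c j k) * gain_family g h p \<omega>)))"
    have "nexp (S n \<omega>) = exp (- (s * N)) * (\<Prod>p\<in>?J. u p \<omega>)" for \<omega>
    proof -
      have "S n \<omega> = (\<Sum>j=1..3. \<Sum>k<n. ennreal (s * c j k * h j k \<omega>)) + ennreal (s * N)"
        using s N by (simp add: S_def distrib_left sum_distrib_left ennreal_mult' mult.assoc)
      then show ?thesis
        using s N by (simp add: nexp_add nexp_sum prod.reindex prod.cartesian_product u_def
            gain_family_def case_prod_beta mult.commute)
    qed
    then have "expectation (\<lambda>\<omega>. nexp (S n \<omega>)) = exp (- (s * N)) * expectation (\<lambda>\<omega>. \<Prod>p\<in>?J. u p \<omega>)"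
      by simp
    also have "expectation (\<lambda>\<omega>. \<Prod>p\<in>?J. u p \<omega>) = (\<Prod>p\<in>?J. expectation (u p))"
    proof (rule indep_vars_lebesgue_integral)
      have "indep_vars (\<lambda>_. borel) (gain_family g h) ?J"
        using ind by (rule indep_vars_subset) (auto simp: gain_index_def)
      then show "indep_vars (\<lambda>_. borel) u ?J"
        unfolding u_def by (rule indep_vars_compose2) measurable
      show "integrable M (u p)" if "p \<in> ?J" for p
        using that by (intro integrable_const_bound[where B = 1]) (auto simp: u_def gain_family_def)
    qed simp
    also have "\<dots> = (\<Prod>p\<in>?J. nexp (ennreal (case p of None \<Rightarrow> 0 | Some (j, k) \<Rightarrow> ln (1 + s * c j k))))"
    proof (rule prod.cong[OF refl])
      fix p assume "p \<in> ?J"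
      then obtain j k where p: "p = Some (j, k)" "j \<in> {1..3}" by auto
      have "1 + s * c j k > 0" using s c[of j k] by (intro add_pos_nonneg) auto
      then show "expectation (u p) = nexp (ennreal (case p of None \<Rightarrow> 0 | Some (j, k) \<Rightarrow> ln (1 + s * c j k)))"
        using expectation_nexp_exponential[OF hd[OF p(2)], of "s * c j k" k] s c[of j k] ln_nonneg
        by (simp add: p u_def gain_family_def exp_minus divide_inverse)
    qed
    also have "\<dots> = (\<Prod>j=1..3. nexp (\<Sum>k<n. ennreal (ln (1 + s * c j k))))"
      by (simp add: nexp_sum prod.reindex prod.cartesian_product case_prod_beta)
    finally show ?thesis by (simp add: L_def)
  qed
  have lim1: "(\<lambda>n. expectation (\<lambda>\<omega>. nexp (S n \<omega>))) \<longlonglongrightarrow> expectation (\<lambda>\<omega>. nexp (T \<omega>))"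
  proof (rule integral_dominated_convergence[where w = "\<lambda>_. 1"])
    show "AE \<omega> in M. (\<lambda>n. nexp (S n \<omega>)) \<longlonglongrightarrow> nexp (T \<omega>)"
      unfolding S_def T_def
      by (intro AE_I2 tendsto_nexp ennreal_tendsto_cmult tendsto_add tendsto_sum tendsto_const summable_LIMSEQ) auto
    show "(\<lambda>\<omega>. nexp (S n \<omega>)) \<in> borel_measurable M" for n
      unfolding S_def by measurable
  qed auto
  have lim2: "L \<longlonglongrightarrow> exp (- (s * N)) * (\<Prod>j=1..3. nexp (\<Sum>k. ennreal (ln (1 + s * c j k))))"
    unfolding L_def by (intro tendsto_mult tendsto_const tendsto_prod tendsto_nexp summable_LIMSEQ summableI)
  have ET: "expectation (\<lambda>\<omega>. nexp (T \<omega>)) =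
      exp (- (s * N)) * (\<Prod>j=1..3. nexp (\<Sum>k. ennreal (ln (1 + s * c j k))))"
    using LIMSEQ_unique[OF lim1[unfolded ES] lim2] .
  have "{\<omega>\<in>space M. ennreal (w * g \<omega>) /
      ((\<Sum>j=1..3. \<Sum>k. ennreal (c j k * h j k \<omega>)) + ennreal N) \<le> ennreal t} =
      space M - {\<omega>\<in>space M. T \<omega> < ennreal (g \<omega>)}"
    using ennreal_divide_le_iff[OF w t] by (auto simp: T_def s_def not_less)
  then have "prob {\<omega>\<in>space M. ennreal (w * g \<omega>) /
      ((\<Sum>j=1..3. \<Sum>k. ennreal (c j k * h j k \<omega>)) + ennreal N) \<le> ennreal t} =
      1 - prob {\<omega>\<in>space M. T \<omega> < ennreal (g \<omega>)}"
    by (simp add: prob_compl)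
  then show ?thesis unfolding gt ET s_def .
qed

section \<open>Outage at a fixed serving distance\<close>

lemma Z1_nonneg:
  assumes "\<beta> > 2" "s > 0" shows "0 \<le> Z1 \<beta> s"
proof -
  let ?f = "\<lambda>u. 1 / (1 + s * u powr (\<beta> / (\<beta> - 2)))"
  have "0 \<le> integral {0..1} ?f"
  \<comment> \<open>In the other case the integral is 0 by convention, so integrability need not be
    shown here.\<close>
  proof (cases "?f integrable_on {0..1}")
    case True
    then show ?thesis using assms by (intro Henstock_Kurzweil_Integration.integral_nonneg) auto
  qed (simp add: not_integrable_integral)
  then show ?thesis using assms by (simp add: Z1_eq_integral)
qed

lemma interference_laplace:
  assumes M: "prob_space M" and mu: "0 \<le> \<mu>" and r0: "0 < r0" and \<beta>: "\<beta> > 2" and \<tau>: "\<tau> > 0"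
    and ppp: "homogeneous_ppp M \<mu> {z. r0 \<le> norm z} Y"
  shows "(\<integral>\<omega>. nexp (\<Sum>k. ennreal (ln (1 + \<tau> * r0 powr \<beta> * norm (Y k \<omega>) powr (- \<beta>)))) \<partial>M) =
           exp (- (\<mu> * pi * r0\<^sup>2 * Z1 \<beta> \<tau>))"
proof -
  define a where "a = \<tau> * r0 powr \<beta>"
  have a: "0 \<le> a" using \<tau> by (simp add: a_def)
  \<comment> \<open>Cutting off inside the exclusion disc meets the support condition of
    \<open>ppp_laplace\<close> and almost surely changes the value at no point of the
    process.\<close>
  define f where "f = (\<lambda>z::real^2. ennreal (ln (1 + a * norm z powr (- \<beta>))) * indicator {z. r0 \<le> norm z} z)"
  have f [measurable]: "f \<in> borel_measurable borel" unfolding f_def by measurable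
  have Ym [measurable]: "Y k \<in> borel_measurable M" for k using ppp by (auto simp: homogeneous_ppp_def)
  have ae: "AE \<omega> in M. \<forall>k. Y k \<omega> \<in> {z. r0 \<le> norm z}" using ppp by (auto simp: homogeneous_ppp_def)
  have "(\<integral>\<omega>. nexp (\<Sum>k. ennreal (ln (1 + a * norm (Y k \<omega>) powr (- \<beta>)))) \<partial>M) =
      (\<integral>\<omega>. nexp (\<Sum>k. f (Y k \<omega>)) \<partial>M)"
    by (intro integral_cong_AE AE_mp[OF ae AE_I2]) (auto simp: f_def)
  also have "\<dots> = nexp (ennreal \<mu> * (\<integral>\<^sup>+z. ennreal (1 - nexp (f z)) \<partial>lborel))"
    by (intro ppp_laplace[OF M ppp mu]) (auto simp: f_def)
  also have "(\<integral>\<^sup>+z. ennreal (1 - nexp (f z)) \<partial>lborel) =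
      (\<integral>\<^sup>+z. ennreal (1 - 1 / (1 + a * norm z powr (- \<beta>))) * indicator {z. r0 \<le> norm z} z
            \<partial>(lborel :: (real^2) measure))"
  proof (intro nn_integral_cong)
    fix z :: "real^2"
    have "0 \<le> a * norm z powr (- \<beta>)" using a by simp
    moreover from this have "0 < 1 + a * norm z powr (- \<beta>)" by linarith
    ultimately have "nexp (ennreal (ln (1 + a * norm z powr (- \<beta>)))) = 1 / (1 + a * norm z powr (- \<beta>))"
      by (simp add: exp_minus inverse_eq_divide)
    then show "ennreal (1 - nexp (f z)) =
        ennreal (1 - 1 / (1 + a * norm z powr (- \<beta>))) * indicator {z. r0 \<le> norm z} z"
      by (simp add: f_def split: split_indicator)
  qed
  also have "\<dots> = ennreal (pi * r0\<^sup>2 * Z1 \<beta> \<tau>)"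
    unfolding nn_integral_interference[OF \<beta> \<tau> r0 a_def] Z1_eq_integral[OF \<beta> \<tau>] ..
  also have "nexp (ennreal \<mu> * ennreal (pi * r0\<^sup>2 * Z1 \<beta> \<tau>)) = exp (- (\<mu> * pi * r0\<^sup>2 * Z1 \<beta> \<tau>))"
    using mu Z1_nonneg[OF \<beta> \<tau>] by (simp add: mult.assoc flip: ennreal_mult)
  finally show ?thesis unfolding a_def .
qed

lemma (in prob_space) prod_interference_laplace:
  assumes ind: "indep_vars (\<lambda>_. PiM (sets borel) (\<lambda>_. borel))
       (\<lambda>j \<omega>. \<lambda>A\<in>sets borel. point_count (Y j) A \<omega>) J"
    and J: "finite J" and Y [measurable]: "\<And>j k. j \<in> J \<Longrightarrow> Y j k \<in> borel_measurable M"
    and f [measurable]: "\<And>j. f j \<in> borel_measurable borel"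
  shows "expectation (\<lambda>\<omega>. \<Prod>j\<in>J. nexp (\<Sum>k. f j (Y j k \<omega>))) =
           (\<Prod>j\<in>J. expectation (\<lambda>\<omega>. nexp (\<Sum>k. f j (Y j k \<omega>))))"
proof (rule indep_vars_lebesgue_integral[OF J])
  have "\<exists>\<Phi>. \<Phi> \<in> borel_measurable (PiM (sets borel) (\<lambda>_. borel)) \<and>
    (\<forall>Y (\<omega>::'a). (\<Sum>k. f j (Y k \<omega>)) = \<Phi> (\<lambda>A\<in>sets borel. point_count Y A \<omega>))" for j
    by (rule suminf_point_process_factorization[OF f[of j]]) blast
  then obtain \<Phi> where \<Phi>: "\<And>j. \<Phi> j \<in> borel_measurable (PiM (sets borel) (\<lambda>_. borel))"
    "\<And>j Y (\<omega>::'a). (\<Sum>k. f j (Y k \<omega>)) = \<Phi> j (\<lambda>A\<in>sets borel. point_count Y A \<omega>)"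
    by metis
  have "indep_vars (\<lambda>_. borel) (\<lambda>j \<omega>. nexp (\<Phi> j (\<lambda>A\<in>sets borel. point_count (Y j) A \<omega>))) J"
    by (rule indep_vars_compose2[OF ind]) (intro measurable_compose[OF \<Phi>(1) measurable_nexp])
  then show "indep_vars (\<lambda>_. borel) (\<lambda>j \<omega>. nexp (\<Sum>k. f j (Y j k \<omega>))) J"
    by (simp only: \<Phi>(2))
  show "integrable M (\<lambda>\<omega>. nexp (\<Sum>k. f j (Y j k \<omega>)))" if [simp]: "j \<in> J" for j
    by (rule integrable_const_bound[where B = 1]) auto
qed

text \<open>Freezing the positions reduces to \<open>outage_fixed_positions\<close>; averaging over
  them leaves a product of Laplace functionals, one per tier.\<close>

theorem conditional_outage:
  assumes M: "prob_space M" and net: "conditional_network d P \<beta> i x M g h Y"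
    and P: "\<And>j. j \<in> {1..3} \<Longrightarrow> 0 < P j" and d: "\<And>j. j \<in> {1..3} \<Longrightarrow> 0 \<le> d j"
    and i: "i \<in> {1..3}" and x: "0 < x" and \<beta>: "2 < \<beta>" and \<tau>: "0 < \<tau>"
  shows "measure M {\<omega>\<in>space M. sinr P \<beta> \<sigma> i g h Y x \<omega> \<le> ennreal \<tau>} =
    1 - exp (- (x powr \<beta> * \<sigma>\<^sup>2 * \<tau> / P i)) *
        exp (- (pi * x\<^sup>2 * Z1 \<beta> \<tau> * (\<Sum>j=1..3. d j * (P j / P i) powr (2 / \<beta>))))"
proof -
  interpret prob_space M by fact
  note net' = net[unfolded conditional_network_def]
  have ppp: "homogeneous_ppp M (d j) {z. x * (P j / P i) powr (1 / \<beta>) \<le> norm z} (Y j)" if "j \<in> {1..3}" for j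
    using net' that by blast
  have tiers: "indep_vars (\<lambda>_. PiM (sets borel) (\<lambda>_. borel))
       (\<lambda>j \<omega>. \<lambda>A\<in>sets borel. point_count (Y j) A \<omega>) {1..3}"
    using net' by blast
  have dist: "distributed M lborel (gain_family g h p) (\<lambda>t. ennreal (exponential_density 1 t))"
    if "p \<in> gain_index" for p using net' that by blast
  have gains: "indep_vars (\<lambda>_. borel) (gain_family g h) gain_index" using net' by blast
  have Ym [measurable]: "Y j k \<in> borel_measurable M" if "j \<in> {1..3}" for j k
    using ppp[OF that] by (simp add: homogeneous_ppp_def)
  have gainm [measurable]: "gain_family g h p \<in> borel_measurable M" if "p \<in> gain_index" for p
    using distributed_measurable[OF dist[OF that]] by simp
  have gm [measurable]: "g \<in> borel_measurable M"
    using gainm[of None] by (simp add: gain_family_def gain_index_def)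
  have hm [measurable]: "h j k \<in> borel_measurable M" if "j \<in> {1..3}" for j k
    using gainm[of "Some (j, k)"] that by (simp add: gain_family_def gain_index_def)

  let ?G = "\<lambda>\<omega>. \<lambda>p\<in>gain_index. gain_family g h p \<omega>"
  let ?V = "\<lambda>\<omega>. \<lambda>(j, k)\<in>{1..3} \<times> UNIV. Y j k \<omega>"
  let ?MG = "PiM gain_index (\<lambda>_. borel :: real measure)"
  let ?MV = "PiM ({1..3::nat} \<times> (UNIV :: nat set)) (\<lambda>_. borel :: (real^2) measure)"
  have Gm: "?G \<in> measurable M ?MG" by (intro measurable_restrict) simp
  have Vm: "?V \<in> measurable M ?MV" by (intro measurable_restrict) auto
  have indep: "indep_set (sets (vimage_algebra (space M) ?G ?MG)) (sets (vimage_algebra (space M) ?V ?MV))"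
    using net' by blast

  define w where "w = P i * x powr (- \<beta>)"
  have w: "0 < w" using P[OF i] x by (simp add: w_def)
  define s where "s = \<tau> / w"
  have s: "0 < s" using w \<tau> by (simp add: s_def)
  \<comment> \<open>The junk index makes the weights nonnegative also outside the three tiers.\<close>
  define c where "c = (\<lambda>j z. P (if j \<in> {1..3} then j else 1) * norm (z::real^2) powr (- \<beta>))"
  have c: "0 \<le> c j z" for j z using P[of j] P[of 1] by (auto simp: c_def)
  \<comment> \<open>The SINR as a function of the gains a and the positions b, so that its two
    arguments can be evaluated at different outcomes.\<close>
  define R where "R = (\<lambda>a b. ennreal (w * a None) /
      ((\<Sum>j=1..3. \<Sum>k. ennreal (c j (b (j, k)) * a (Some (j, k)))) + ennreal (\<sigma>\<^sup>2)))"
  have Rm: "(\<lambda>(a, b). R a b) \<in> borel_measurable (?MG \<Otimes>\<^sub>M ?MV)"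
  proof -
    have [measurable]: "(\<lambda>a. a (Some (j, k))) \<in> borel_measurable ?MG" "(\<lambda>b. b (j, k)) \<in> borel_measurable ?MV"
      if "j \<in> {1..3}" for j k
      using that by (intro measurable_component_singleton; simp add: gain_index_def)+
    have [measurable]: "(\<lambda>a. a None) \<in> borel_measurable ?MG"
      by (intro measurable_component_singleton) (simp add: gain_index_def)
    show ?thesis unfolding R_def c_def by measurable
  qed
  have R_eq: "R (?G \<omega>) (?V \<omega>') = ennreal (w * g \<omega>) /
      ((\<Sum>j=1..3. \<Sum>k. ennreal (c j (Y j k \<omega>') * h j k \<omega>)) + ennreal (\<sigma>\<^sup>2))" for \<omega> \<omega>'
    unfolding R_def by (intro arg_cong2[where f = divide] arg_cong2[where f = "(+)"] sum.cong
       refl suminf_cong arg_cong[where f = ennreal]) (auto simp: gain_family_def gain_index_def)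
  have sinr_eq: "sinr P \<beta> \<sigma> i g h Y x \<omega> = R (?G \<omega>) (?V \<omega>)" for \<omega>
    unfolding R_eq sinr_def by (intro arg_cong2[where f = divide] arg_cong2[where f = "(+)"] sum.cong
       refl suminf_cong arg_cong[where f = ennreal]) (auto simp: c_def w_def)
  have sm: "(\<lambda>\<omega>. R (?G \<omega>) (?V \<omega>)) \<in> borel_measurable M"
    unfolding R_eq c_def by measurable
  have sm': "(\<lambda>\<omega>. R (?G \<omega>) (?V \<omega>')) \<in> borel_measurable M" for \<omega>'
    unfolding R_eq by measurable
  define Q where "Q = (\<lambda>\<omega>. \<Prod>j=1..3. nexp (\<Sum>k. ennreal (ln (1 + s * c j (Y j k \<omega>)))))"
  have Qm [measurable]: "Q \<in> borel_measurable M" unfolding Q_def c_def by measurable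
  have Q01: "0 \<le> Q \<omega>" "Q \<omega> \<le> 1" for \<omega> by (auto simp: Q_def intro!: prod_nonneg prod_le_1)
  define u where "u = exp (- (s * \<sigma>\<^sup>2))"
  have u01: "0 \<le> u" "u \<le> 1" using s by (auto simp: u_def)
  have uQ: "0 \<le> 1 - u * Q \<omega>" for \<omega> using u01 Q01 by (simp add: mult_le_one)
  let ?A = "{t. t \<le> ennreal \<tau>}"
  have "emeasure M {\<omega>\<in>space M. R (?G \<omega>) (?V \<omega>) \<in> ?A} = (\<integral>\<^sup>+\<omega>. indicator ?A (R (?G \<omega>) (?V \<omega>)) \<partial>M)"
    using sm by (intro emeasure_eq_nn_integral_indicator) measurable
  also have "\<dots> = (\<integral>\<^sup>+\<omega>. (indicator ?A \<circ> (\<lambda>(a, b). R a b)) (?G \<omega>, ?V \<omega>) \<partial>M)"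
    by simp
  also have "\<dots> = (\<integral>\<^sup>+\<omega>'. \<integral>\<^sup>+\<omega>. (indicator ?A \<circ> (\<lambda>(a, b). R a b)) (?G \<omega>, ?V \<omega>') \<partial>M \<partial>M)"
    by (intro indep_set_nn_integral[OF Gm Vm indep] measurable_comp[OF Rm]) measurable
  also have "\<dots> = (\<integral>\<^sup>+\<omega>'. emeasure M {\<omega>\<in>space M. R (?G \<omega>) (?V \<omega>') \<in> ?A} \<partial>M)"
  proof (intro nn_integral_cong)
    fix \<omega>'
    have "{\<omega>\<in>space M. R (?G \<omega>) (?V \<omega>') \<in> ?A} \<in> sets M" using sm'[of \<omega>'] by measurable
    from emeasure_eq_nn_integral_indicator[OF this]
    show "(\<integral>\<^sup>+\<omega>. (indicator ?A \<circ> (\<lambda>(a, b). R a b)) (?G \<omega>, ?V \<omega>') \<partial>M) =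
      emeasure M {\<omega>\<in>space M. R (?G \<omega>) (?V \<omega>') \<in> ?A}" by simp
  qed
  also have "\<dots> = (\<integral>\<^sup>+\<omega>'. ennreal (1 - u * Q \<omega>') \<partial>M)"
  proof (intro nn_integral_cong)
    fix \<omega>'
    have "prob {\<omega>\<in>space M. R (?G \<omega>) (?V \<omega>') \<in> ?A} = 1 - u * Q \<omega>'"
      unfolding R_eq mem_Collect_eq u_def Q_def s_def
      by (intro outage_fixed_positions dist gains w \<tau> c) auto
    then show "emeasure M {\<omega>\<in>space M. R (?G \<omega>) (?V \<omega>') \<in> ?A} = ennreal (1 - u * Q \<omega>')"
      by (simp only: emeasure_eq_measure)
  qed
  finally have "prob {\<omega>\<in>space M. sinr P \<beta> \<sigma> i g h Y x \<omega> \<le> ennreal \<tau>} = expectation (\<lambda>\<omega>. 1 - u * Q \<omega>)"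
    using uQ by (simp add: measure_def integral_eq_nn_integral sinr_eq)
  also have "\<dots> = 1 - u * expectation Q"
  proof -
    have "integrable M Q" using Q01 by (intro integrable_const_bound[where B = 1]) auto
    then show ?thesis by (simp add: prob_space)
  qed
  also have "expectation Q = (\<Prod>j=1..3. expectation (\<lambda>\<omega>. nexp (\<Sum>k. ennreal (ln (1 + s * c j (Y j k \<omega>))))))"
    unfolding Q_def using tiers by (intro prod_interference_laplace) (auto simp: c_def)
  also have "\<dots> = (\<Prod>j=1..3. exp (- (pi * x\<^sup>2 * Z1 \<beta> \<tau> * (d j * (P j / P i) powr (2 / \<beta>)))))"
  proof (rule prod.cong[OF refl])
    fix j :: nat assume j: "j \<in> {1..3}"
    define r0 where "r0 = x * (P j / P i) powr (1 / \<beta>)"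
    have r0: "0 < r0" using x P[OF i] P[OF j] by (simp add: r0_def)
    have r0\<beta>: "r0 powr \<beta> = x powr \<beta> * (P j / P i)"
      using x P[OF i] P[OF j] \<beta> by (simp add: r0_def powr_mult powr_powr)
    have "((P j / P i) powr (1 / \<beta>))\<^sup>2 = (P j / P i) powr (2 / \<beta>)"
      using P[OF i] P[OF j] by (simp add: powr_powr flip: powr_realpow)
    then have r02: "r0\<^sup>2 = x\<^sup>2 * (P j / P i) powr (2 / \<beta>)" by (simp add: r0_def power_mult_distrib)
    \<comment> \<open>The coefficient is s * P j = \<tau> * x powr \<beta> * P j / P i, and the
      exclusion radius satisfies r0 powr \<beta> = x powr \<beta> * P j / P i. Hence the same
      \<open>Z1 \<beta> \<tau>\<close> occurs for every tier.\<close>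
    have "s * c j z = \<tau> * r0 powr \<beta> * norm z powr (- \<beta>)" for z
      using j x P[OF i] unfolding r0\<beta> by (simp add: s_def w_def c_def powr_minus field_simps)
    then show "expectation (\<lambda>\<omega>. nexp (\<Sum>k. ennreal (ln (1 + s * c j (Y j k \<omega>))))) =
        exp (- (pi * x\<^sup>2 * Z1 \<beta> \<tau> * (d j * (P j / P i) powr (2 / \<beta>))))"
      using interference_laplace[OF M d[OF j] r0 \<beta> \<tau> ppp[OF j, folded r0_def]]
      by (simp add: r02 mult_ac)
  qed
  also have "\<dots> = exp (- (pi * x\<^sup>2 * Z1 \<beta> \<tau> * (\<Sum>j=1..3. d j * (P j / P i) powr (2 / \<beta>))))"
    by (simp add: exp_sum sum_distrib_left flip: sum_negf)
  also have "u = exp (- (x powr \<beta> * \<sigma>\<^sup>2 * \<tau> / P i))"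
    using x P[OF i] by (simp add: u_def s_def w_def powr_minus field_simps)
  finally show ?thesis .
qed

section \<open>Averaging over the serving distance\<close>

lemma assoc_prob_inverse:
  assumes "0 < dens i"
  shows "dens i / assoc_prob dens P \<beta> i = (\<Sum>j=1..3. dens j * (P j / P i) powr (2 / \<beta>))"
proof -
  have "dens i / assoc_prob dens P \<beta> i = dens i * (\<Sum>j=1..3. dens j / dens i * (P j / P i) powr (2 / \<beta>))"
    by (simp add: assoc_prob_def divide_inverse)
  also have "\<dots> = (\<Sum>j=1..3. dens j * (P j / P i) powr (2 / \<beta>))"
    using assms by (simp add: sum_distrib_left)
  finally show ?thesis .
qed

text \<open>Let S_i be the sum with the original densities and q the weight of tier 1. Only tier 1
  changes, so the sum is S_i + (dens' 1 - dens 1) * q. Factoring P 1 / P i out of every power ratio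
  gives S_i = S_1 * q, and S_1 is dens 1 over the association probability of tier 1, so S_i factors
  out.\<close>

lemma active_density_sum:
  assumes dens: "\<And>j. j \<in> {1..3} \<Longrightarrow> 0 < dens j" and P: "\<And>j. j \<in> {1..3} \<Longrightarrow> 0 < P j" and i: "i \<in> {1..3}"
    and dens': "\<And>j. j \<noteq> 1 \<Longrightarrow> dens' j = dens j"
  shows "(\<Sum>j=1..3. dens' j * (P j / P i) powr (2 / \<beta>)) =
    dens i / assoc_prob dens P \<beta> i * ((dens 1 + (dens' 1 - dens 1) * assoc_prob dens P \<beta> 1) / dens 1)"
proof -
  let ?S = "\<lambda>i. \<Sum>j=1..3. dens j * (P j / P i) powr (2 / \<beta>)"
  let ?q = "(P 1 / P i) powr (2 / \<beta>)"
  have one: "(1::nat) \<in> {1..3}" by simp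
  have "0 < dens j * (P j / P 1) powr (2 / \<beta>)" if "j \<in> {1..3}" for j
    using dens[OF that] P[OF that] P[OF one] by simp
  then have S1: "?S 1 > 0" by (intro sum_pos) auto
  have Si: "?S i = ?S 1 * ?q"
    unfolding sum_distrib_right
  proof (rule sum.cong[OF refl])
    fix j :: nat assume "j \<in> {1..3}"
    then have "P j / P i = P j / P 1 * (P 1 / P i)" "0 \<le> P j / P 1" "0 \<le> P 1 / P i"
      using P[of j] P[OF one] P[OF i] by auto
    then show "dens j * (P j / P i) powr (2 / \<beta>) = dens j * (P j / P 1) powr (2 / \<beta>) * ?q"
      by (simp only: powr_mult mult.assoc)
  qed
  have G1: "assoc_prob dens P \<beta> 1 = dens 1 / ?S 1"
    unfolding assoc_prob_inverse[of dens 1 P \<beta>, OF dens[OF one], symmetric] using dens[OF one] by simp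
  have split: "{1..3} = insert (1::nat) {2..3}" by auto
  have "(\<Sum>j=1..3. dens' j * (P j / P i) powr (2 / \<beta>)) = ?S i + (dens' 1 - dens 1) * ?q"
    using dens' unfolding split by (simp add: algebra_simps)
  also have "\<dots> = ?S i * ((dens 1 + (dens' 1 - dens 1) * assoc_prob dens P \<beta> 1) / dens 1)"
    unfolding G1 Si using S1 dens[OF one] by (simp add: field_simps)
  finally show ?thesis unfolding assoc_prob_inverse[of dens i P \<beta>, OF dens[OF i]] .
qed

lemma active_density_nonneg:
  assumes "0 \<le> dens 0" "\<And>j. j \<in> {1..3} \<Longrightarrow> 0 \<le> dens j" "0 \<le> \<alpha>" "\<alpha> \<le> 1" "j \<in> {1..3}"
  shows "0 \<le> active_density dens P \<alpha> \<beta> \<gamma> N M1 j"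
proof -
  have "0 \<le> assoc_prob dens P \<beta> 1" 
    unfolding assoc_prob_def using assms(2)
    by (intro iffD2[OF inverse_nonnegative_iff_nonnegative] sum_nonneg mult_nonneg_nonneg divide_nonneg_nonneg) auto
  moreover have "0 \<le> zipf_sum \<gamma> N 1 M1"
    unfolding zipf_sum_def zipf_def by (intro sum_nonneg divide_nonneg_nonneg) auto
  ultimately show ?thesis
    using assms by (auto simp: active_density_def)
qed

lemma sinr_measurable [measurable]:
  assumes [measurable]: "g \<in> borel_measurable M" "\<And>j k. j \<in> {1..3} \<Longrightarrow> h j k \<in> borel_measurable M"
    "\<And>j k. j \<in> {1..3} \<Longrightarrow> Y j k \<in> borel_measurable M"
  shows "(\<lambda>(x, \<omega>). sinr P \<beta> \<sigma> i g h Y x \<omega>) \<in> borel_measurable (borel \<Otimes>\<^sub>M M)"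
  unfolding sinr_def by measurable

lemma conditional_network_measurable:
  assumes "conditional_network d P \<beta> i x M g h Y"
  shows "g \<in> borel_measurable M" "j \<in> {1..3} \<Longrightarrow> h j k \<in> borel_measurable M"
    "j \<in> {1..3} \<Longrightarrow> Y j k \<in> borel_measurable M"
proof -
  note net = assms[unfolded conditional_network_def]
  have dist: "distributed M lborel (gain_family g h p) (\<lambda>t. ennreal (exponential_density 1 t))"
    if "p \<in> gain_index" for p using net that by blast
  have gm: "gain_family g h p \<in> borel_measurable M" if "p \<in> gain_index" for p
    using distributed_measurable[OF dist[OF that]] by simp
  show "g \<in> borel_measurable M"
    using gm[of None] by (simp add: gain_family_def gain_index_def)
  show "h j k \<in> borel_measurable M" if "j \<in> {1..3}"
    using gm[of "Some (j, k)"] that by (simp add: gain_family_def gain_index_def)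
  show "Y j k \<in> borel_measurable M" if "j \<in> {1..3}"
    using net that by (auto simp: homogeneous_ppp_def)
qed

text \<open>The model prescribes the network only for almost every distance. One good distance
  yields measurability of the gains and positions, because every \<open>K x\<close> has the
  sigma-algebra of \<open>M\<close>.\<close>

lemma ex_positive_of_AE_lborel:
  assumes "AE x in lborel. 0 < (x::real) \<longrightarrow> Q x"
  shows "\<exists>x>0. Q x"
proof (rule ccontr)
  assume neg: "\<not> (\<exists>x>0. Q x)"
  from assms have "AE x in lborel. \<not> (0 < (x::real) \<and> x < 1)"
    by eventually_elim (use neg in blast)
  then have "emeasure lborel {x\<in>space lborel. 0 < (x::real) \<and> x < 1} = 0"
    by (rule emeasure_eq_0_AE)
  moreover have "{x\<in>space lborel. 0 < (x::real) \<and> x < 1} = {0<..<1}" by auto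
  ultimately show False by simp
qed

theorem theorem4:
  fixes dens dens' P :: "nat \<Rightarrow> real"
    and \<alpha> \<beta> \<gamma> \<sigma> \<tau> :: real
    and N M1 i :: nat
    and M :: "'a measure"
    and X :: "'a \<Rightarrow> real"
    and K :: "real \<Rightarrow> 'a measure"
    and g :: "'a \<Rightarrow> real"
    and h :: "nat \<Rightarrow> nat \<Rightarrow> 'a \<Rightarrow> real"
    and Y :: "nat \<Rightarrow> nat \<Rightarrow> 'a \<Rightarrow> real^2"
  assumes "dens 0 > dens 2" and "dens 2 > dens 3" and "dens 3 > 0"
    and "0 < \<alpha>" and "\<alpha> < 1" and "dens 1 = \<alpha> * dens 0"
    and "P 1 > 0" and "P 2 > 0" and "P 3 > 0"
    and "\<beta> > 2" and "\<gamma> \<ge> 0"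
    and "1 \<le> M1" and "M1 \<le> N"
    and "dens' = active_density dens P \<alpha> \<beta> \<gamma> N M1"
    and "i \<in> {1, 2, 3}" and "\<tau> > 0"
    and "case1_model dens dens' P \<beta> i M X K g h Y"
  shows "outage_prob dens P \<beta> \<sigma> \<tau> i K g h Y =
    1 - 2 * pi * dens i / assoc_prob dens P \<beta> i *
      (LBINT x:{0<..}. x * exp (- (x powr \<beta> * \<sigma>\<^sup>2 * \<tau> / P i)
         - pi * dens i * x\<^sup>2 / assoc_prob dens P \<beta> i *
           (1 + (dens 1 + (dens' 1 - dens 1) * assoc_prob dens P \<beta> 1) / dens 1 * Z1 \<beta> \<tau>)))"
proof -
  have three: "j = 1 \<or> j = 2 \<or> j = 3" if "j \<in> {1..3}" for j :: nat using that by auto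
  have i: "i \<in> {1..3}" using assms(15) by auto
  have P: "0 < P j" if "j \<in> {1..3}" for j using three[OF that] assms by auto
  have dens: "0 < dens j" if "j \<in> {1..3}" for j using three[OF that] assms by auto
  have dens0: "0 < dens 0" using assms(1-3) by linarith
  have dens'0: "0 \<le> dens' j" if "j \<in> {1..3}" for j
    unfolding assms(14) using dens0 assms(4,5) that dens
    by (intro active_density_nonneg) (auto intro: less_imp_le)
  have dens'1: "dens' j = dens j" if "j \<noteq> 1" for j
    using that assms(14) by (simp add: active_density_def)
  note model = assms(17)[unfolded case1_model_def]
  interpret M: prob_space M using model by blast
  define f where "f = serving_distance_density dens P \<beta> i"
  define S where "S = dens i / assoc_prob dens P \<beta> i"
  have S_eq: "S = (\<Sum>j=1..3. dens j * (P j / P i) powr (2 / \<beta>))"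
    unfolding S_def by (rule assoc_prob_inverse[of dens i P \<beta>, OF dens[OF i]])
  define c where "c = (dens 1 + (dens' 1 - dens 1) * assoc_prob dens P \<beta> 1) / dens 1"
  have Sc: "(\<Sum>j=1..3. dens' j * (P j / P i) powr (2 / \<beta>)) = S * c"
    unfolding S_def c_def by (rule active_density_sum[OF dens P i dens'1])
  have "0 < dens j * (P j / P i) powr (2 / \<beta>)" if "j \<in> {1..3}" for j
    using dens[OF that] P[OF that] P[OF i] by simp
  then have S0: "0 < S" unfolding S_eq by (intro sum_pos) auto
  have fdist: "distributed M lborel X (\<lambda>x. ennreal (f x))" using model by (simp add: f_def)
  have f_eq: "f x = (if 0 < x then 2 * pi * S * x * exp (- pi * x\<^sup>2 * S) else 0)" for x
    unfolding f_def serving_distance_density_def S_eq[symmetric] S_def by simp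
  have f_neg: "f x = 0" if "\<not> 0 < x" for x using that by (simp add: f_eq)
  have f0: "0 \<le> f x" for x using S0 by (simp add: f_eq)
  have fm [measurable]: "f \<in> borel_measurable borel" unfolding f_eq[abs_def] by measurable
  \<comment> \<open>The total mass follows from \<open>f\<close> being the density of
    \<open>X\<close>; the Gaussian-type integral is not computed.\<close>
  have f1: "(\<integral>\<^sup>+x. ennreal (f x) \<partial>lborel) = 1"
    using distributed_nn_integral[OF fdist, of "\<lambda>_. 1"] M.emeasure_space_1 by simp
  then have fint: "integrable lborel f"
    using f0 by (intro integrableI_nonneg) auto
  have fI: "(\<integral>x. f x \<partial>lborel) = 1"
    using f0 f1 by (simp add: integral_eq_nn_integral)

  have K: "K \<in> borel \<rightarrow>\<^sub>M prob_algebra M" using model by (simp add: regular_cond_prob_def)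
  have Kx: "prob_space (K x)" "sets (K x) = sets M" for x
    using measurable_space[OF K, of x] by (auto simp: space_prob_algebra)
  have net: "AE x in lborel. 0 < x \<longrightarrow> conditional_network dens' P \<beta> i x (K x) g h Y"
    using model by blast
  obtain x0 where x0: "conditional_network dens' P \<beta> i x0 (K x0) g h Y"
    using ex_positive_of_AE_lborel[OF net] by blast
  note meas = conditional_network_measurable[OF x0, unfolded measurable_cong_sets[OF Kx(2) refl]]
  define m where "m x = measure (K x) {\<omega>\<in>space (K x). sinr P \<beta> \<sigma> i g h Y x \<omega> \<le> ennreal \<tau>}" for x
  \<comment> \<open>The event varies with x as well as its law, so kernel measurability is applied
    to the graph of the event in the product space. This is needed to replace \<open>m\<close> under
    the integral by its almost everywhere value.\<close>
  have mm [measurable]: "m \<in> borel_measurable borel"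
  proof -
    have "(\<lambda>x. measure (K x) {\<omega>\<in>space M. sinr P \<beta> \<sigma> i g h Y x \<omega> \<le> ennreal \<tau>}) \<in> borel_measurable borel"
    proof (rule measure_measurable_subprob_algebra2)
      have [measurable]: "(\<lambda>p. sinr P \<beta> \<sigma> i g h Y (fst p) (snd p)) \<in> borel_measurable (borel \<Otimes>\<^sub>M M)"
        using sinr_measurable[OF meas] by (simp add: case_prod_beta)
      have "(SIGMA x:space borel. {\<omega>\<in>space M. sinr P \<beta> \<sigma> i g h Y x \<omega> \<le> ennreal \<tau>}) =
          {p\<in>space (borel \<Otimes>\<^sub>M M). sinr P \<beta> \<sigma> i g h Y (fst p) (snd p) \<le> ennreal \<tau>}"
        by (auto simp: space_pair_measure)
      also have "\<dots> \<in> sets (borel \<Otimes>\<^sub>M M)" by measurable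
      finally show "(SIGMA x:space borel. {\<omega>\<in>space M. sinr P \<beta> \<sigma> i g h Y x \<omega> \<le> ennreal \<tau>})
          \<in> sets (borel \<Otimes>\<^sub>M M)" .
    qed (rule measurable_prob_algebraD[OF K])
    then show ?thesis
      using sets_eq_imp_space_eq[OF Kx(2)] by (simp add: m_def[abs_def])
  qed
  define u where "u x = exp (- (x powr \<beta> * \<sigma>\<^sup>2 * \<tau> / P i)) * exp (- (pi * x\<^sup>2 * Z1 \<beta> \<tau> * (S * c)))" for x
  have um [measurable]: "u \<in> borel_measurable borel" unfolding u_def by measurable
  have m_eq: "AE x in lborel. 0 < x \<longrightarrow> m x = 1 - u x"
    using net
  proof eventually_elim
    case (elim x)
    show ?case
      unfolding m_def u_def Sc[symmetric]
      by (intro impI conditional_outage[where d = dens', OF Kx(1) _ P dens'0 i _ assms(10,16)] mp[OF elim])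
  qed
  have Sc0: "0 \<le> S * c"
    unfolding Sc[symmetric] using dens'0 by (intro sum_nonneg mult_nonneg_nonneg) auto
  have u01: "0 \<le> u x" "u x \<le> 1" for x
  proof -
    have "exp (- (x powr \<beta> * \<sigma>\<^sup>2 * \<tau> / P i)) \<le> 1" "exp (- (pi * x\<^sup>2 * Z1 \<beta> \<tau> * (S * c))) \<le> 1"
      using P[OF i] assms(10,16) Z1_nonneg[of \<beta> \<tau>] Sc0 by auto
    then show "u x \<le> 1" unfolding u_def by (intro mult_le_one) auto
  qed (simp add: u_def)
  have ufint: "integrable lborel (\<lambda>x. u x * f x)"
    using u01 f0 by (intro Bochner_Integration.integrable_bound[OF fint]) (auto simp: abs_mult mult_left_le_one_le)
  have "outage_prob dens P \<beta> \<sigma> \<tau> i K g h Y = (\<integral>x. indicator {0<..} x *\<^sub>R (m x * f x) \<partial>lborel)"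
    by (simp add: outage_prob_def set_lebesgue_integral_def m_def f_def)
  also have "\<dots> = (\<integral>x. f x - u x * f x \<partial>lborel)"
    by (intro integral_cong_AE AE_mp[OF m_eq AE_I2])
       (auto simp: f_neg left_diff_distrib split: split_indicator)
  also have "\<dots> = 1 - (\<integral>x. u x * f x \<partial>lborel)"
    using fint ufint by (simp add: fI)
  also have "(\<integral>x. u x * f x \<partial>lborel) = (\<integral>x. 2 * pi * S * (indicator {0<..} x *\<^sub>R (x * exp (- (x powr \<beta> * \<sigma>\<^sup>2 * \<tau> / P i)
         - pi * S * x\<^sup>2 * (1 + c * Z1 \<beta> \<tau>)))) \<partial>lborel)"
  proof (intro Bochner_Integration.integral_cong refl)
    fix x
    \<comment> \<open>In the bracket, 1 comes from the serving-distance density and c *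
      \<open>Z1 \<beta> \<tau>\<close> from the interference.\<close>
    have "exp (- (x powr \<beta> * \<sigma>\<^sup>2 * \<tau> / P i) - pi * S * x\<^sup>2 * (1 + c * Z1 \<beta> \<tau>)) = u x * exp (- pi * x\<^sup>2 * S)"
      by (simp add: u_def algebra_simps flip: exp_add)
    then show "u x * f x = 2 * pi * S * (indicator {0<..} x *\<^sub>R (x * exp (- (x powr \<beta> * \<sigma>\<^sup>2 * \<tau> / P i)
         - pi * S * x\<^sup>2 * (1 + c * Z1 \<beta> \<tau>))))"
      by (simp add: f_eq)
  qed
  also have "\<dots> = 2 * pi * S * (LBINT x:{0<..}. x * exp (- (x powr \<beta> * \<sigma>\<^sup>2 * \<tau> / P i)
         - pi * S * x\<^sup>2 * (1 + c * Z1 \<beta> \<tau>)))"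
    by (simp add: set_lebesgue_integral_def)
  finally show ?thesis
    by (simp add: S_def c_def)
qed

end
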